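(* Let $f:\mathbb{R}^d\to\mathbb{R}$ be twice differentiable and $\mu$-strongly convex with $\mu>0$, let $\nabla f$ be Lipschitz continuous with constant $L>0$, and let $\nabla^2 f$ be Lipschitz continuous with constant $M>0$ (i.e. $\|\nabla^2f(x)-\nabla^2f(y)\|\le M\|x-y\|$ for all $x,y$). Let $\kappa=L/\mu$ and let $x_*$ be the minimizer of $f$. Let $\{x_t\}_{t\ge 0}$ be the iterates generated by BFGS, where at every iteration the step size satisfies the Armijo-Wolfe conditions with parameters $\alpha,\beta$, and let $x_0\in\mathbb{R}^d$ be an arbitrary initial point. Consider the bound $$\frac{f(x_t)-f(x_* )}{f(x_0)-f(x_* )}\le\left(1-\frac{2\alpha(1-\beta)}{3}\right)^{t}.\qquad(\ast)$$ (i) If $B_0=LI$, then $(\ast)$ holds for all $t\ge d\kappa+\frac{9}{\alpha(1-\beta)}C_0\kappa$. (ii) If $B_0=\mu I$, then $(\ast)$ holds for all $t\ge(1+3C_0)d\log\kappa+\frac{9}{\alpha(1-\beta)}C_0\kappa$.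
   Context: BFGS method: given $x_0\in\mathbb{R}^d$ and a symmetric positive definite $B_0\in\mathbb{R}^{d\times d}$, for $t\ge0$ set $g_t=\nabla f(x_t)$, $d_t=-B_t^{-1}g_t$, $x_{t+1}=x_t+\eta_t d_t$ with step size $\eta_t>0$, $s_t=x_{t+1}-x_t$, $y_t=\nabla f(x_{t+1})-\nabla f(x_t)$, and $$B_{t+1}=B_t-\frac{B_ts_ts_t^\top B_t}{s_t^\top B_ts_t}+\frac{y_ty_t^\top}{s_t^\top y_t}.$$ The iterates are assumed non-optimal ($g_t\neq0$), so that all quantities are well defined. Armijo-Wolfe conditions on $\eta_t$, with parameters $0<\alpha<\beta<1$ and $0<\alpha<\frac12$: $$f(x_t+\eta_td_t)\le f(x_t)+\alpha\eta_t\nabla f(x_t)^\top d_t,\qquad \nabla f(x_t+\eta_td_t)^\top d_t\ge\beta\nabla f(x_t)^\top d_t.$$ $C_t:=\frac{M}{\mu^{3/2}}\sqrt{2(f(x_t)-f(x_* ))}$ for $t\ge0$. *)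

theory Defs
  imports "HOL-Analysis.Analysis"
begin

text \<open>
  Strong convexity is stated by the Jensen-type inequality and so presupposes no
  differentiability.
\<close>

definition strongly_convex :: "real \<Rightarrow> ('a::real_normed_vector \<Rightarrow> real) \<Rightarrow> bool" where
  "strongly_convex \<mu> f \<longleftrightarrow>
     (\<forall>x y. \<forall>\<theta>\<in>{0..1}.
        f ((1 - \<theta>) *\<^sub>R x + \<theta> *\<^sub>R y)
          \<le> (1 - \<theta>) * f x + \<theta> * f y - \<mu> / 2 * \<theta> * (1 - \<theta>) * (norm (x - y))\<^sup>2)"

definition has_gradient_hessian :: "(real^'n \<Rightarrow> real) \<Rightarrow> (real^'n \<Rightarrow> real^'n) \<Rightarrow> (real^'n \<Rightarrow> real^'n^'n) \<Rightarrow> bool" where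
  "has_gradient_hessian f g H \<longleftrightarrow>
     (\<forall>x. GDERIV f x :> g x) \<and> (\<forall>x. (g has_derivative (\<lambda>h. H x *v h)) (at x))"

text \<open>The spectral norm; \<open>norm\<close> on type \<open>real^'n^'n\<close> is the Frobenius norm.\<close>

definition spectral_norm :: "real^'n^'m \<Rightarrow> real" where
  "spectral_norm A = onorm (\<lambda>v. A *v v)"

definition symmetric_pos_def :: "real^'n^'n \<Rightarrow> bool" where
  "symmetric_pos_def A \<longleftrightarrow> transpose A = A \<and> (\<forall>v. v \<noteq> 0 \<longrightarrow> v \<bullet> (A *v v) > 0)"

definition outer :: "real^'m \<Rightarrow> real^'n \<Rightarrow> real^'n^'m" where
  "outer u v = (\<chi> i j. u $ i * v $ j)"

definition bfgs_update :: "real^'n^'n \<Rightarrow> real^'n \<Rightarrow> real^'n \<Rightarrow> real^'n^'n" where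
  "bfgs_update B s y =
     B - (1 / (s \<bullet> (B *v s))) *\<^sub>R (B ** outer s s ** B) + (1 / (s \<bullet> y)) *\<^sub>R outer y y"

definition bfgs_direction :: "real^'n^'n \<Rightarrow> real^'n \<Rightarrow> real^'n" where
  "bfgs_direction B v = - (matrix_inv B *v v)"

text \<open>The requirement \<open>g (x t) \<noteq> 0\<close> is the standing assumption of non-optimal iterates.\<close>

definition bfgs_sequence ::
  "(real^'n \<Rightarrow> real^'n) \<Rightarrow> (nat \<Rightarrow> real) \<Rightarrow> (nat \<Rightarrow> real^'n) \<Rightarrow> (nat \<Rightarrow> real^'n^'n) \<Rightarrow> bool" where
  "bfgs_sequence g \<eta> x B \<longleftrightarrow>
     symmetric_pos_def (B 0) \<and>
     (\<forall>t. g (x t) \<noteq> 0 \<and> \<eta> t > 0 \<and>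
          x (Suc t) = x t + \<eta> t *\<^sub>R bfgs_direction (B t) (g (x t)) \<and>
          B (Suc t) = bfgs_update (B t) (x (Suc t) - x t) (g (x (Suc t)) - g (x t)))"

definition armijo_wolfe ::
  "real \<Rightarrow> real \<Rightarrow> (real^'n \<Rightarrow> real) \<Rightarrow> (real^'n \<Rightarrow> real^'n) \<Rightarrow> real^'n \<Rightarrow> real^'n \<Rightarrow> real \<Rightarrow> bool" where
  "armijo_wolfe \<alpha> \<beta> f g x p \<eta> \<longleftrightarrow>
     f (x + \<eta> *\<^sub>R p) \<le> f x + \<alpha> * \<eta> * (g x \<bullet> p) \<and>
     g (x + \<eta> *\<^sub>R p) \<bullet> p \<ge> \<beta> * (g x \<bullet> p)"

definition C_const :: "real \<Rightarrow> real \<Rightarrow> (real^'n \<Rightarrow> real) \<Rightarrow> real^'n \<Rightarrow> real^'n \<Rightarrow> real" where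
  "C_const M \<mu> f xopt x = M / \<mu> powr (3/2) * sqrt (2 * (f x - f xopt))"

end

theory Submission
  imports Defs
begin

text \<open>
  Fix a positive definite weight \<open>P\<close> and consider the divergence
  \<open>D(B) = tr (P\<^sup>-\<^sup>1 B) - d - ln (det B / det P)\<close>, which is nonnegative because it is the sum of
  \<open>c - 1 - ln c\<close> over the generalised eigenvalues \<open>c\<close> of \<open>B\<close> relative to \<open>P\<close>. One BFGS update
  changes it by at most \<open>(y \<bullet> P\<^sup>-\<^sup>1 y) / (s \<bullet> y) - 1 + ln w\<close>
  (\<open>logdet_divergence_bfgs_update\<close>), where \<open>w\<close> measures how well the step is aligned with the
  weighted negative gradient in relation to the curvature along it. The same \<open>w\<close> governs progress: by
  the Armijo--Wolfe conditions the function value drops by at least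
  \<open>\<alpha> (1 - \<beta>) w (g \<bullet> P\<^sup>-\<^sup>1 g)\<close> (\<open>gap_decrease\<close>). Since \<open>D\<close> stays nonnegative, the geometric mean of
  the \<open>w\<close> is bounded below, and hence so is the average relative decrease, provided that \<open>P\<close> is
  comparable to the Hessian: an upper bound on the Hessian controls \<open>(y \<bullet> P\<^sup>-\<^sup>1 y) / (s \<bullet> y)\<close>
  (\<open>weighted_cocoercivity\<close>), a lower bound controls the gap \<open>f(x) - f(x\<^sub>*)\<close> by \<open>g \<bullet> P\<^sup>-\<^sup>1 g\<close>
  (\<open>weighted_gap_bound\<close>). The outcome is \<open>weighted_linear_rate\<close>, which is used for two weights.

  For \<open>P = L I\<close> it gives, once \<open>t\<close> exceeds the initial divergence, a linear rate that degrades with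
  the condition number \<open>\<kappa>\<close>. For \<open>P = H(x\<^sub>*)\<close> the comparison constants at \<open>x\<^sub>t\<close> are \<open>1 + C\<^sub>t\<close>, with
  \<open>C\<^sub>t\<close> proportional to the square root of the current gap, so that the rate is free of \<open>\<kappa>\<close> as soon
  as \<open>t\<close> exceeds the initial divergence plus \<open>2 (C\<^sub>0 + C\<^sub>1 + \<dots>)\<close>. The first rate makes the
  \<open>C\<^sub>t\<close> summable, with a sum of order \<open>C\<^sub>0 \<kappa>\<close>. It then remains to bound the initial divergences. For
  \<open>B\<^sub>0 = L I\<close> they are zero and at most \<open>d \<kappa>\<close>, and for \<open>B\<^sub>0 = \<mu> I\<close> both are at most \<open>d ln \<kappa>\<close>.
\<close>

section \<open>Simultaneous diagonalisation of quadratic forms\<close>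

lemma inner_matrix_symmetric:
  fixes A :: "real^'n^'n"
  assumes "transpose A = A"
  shows "u \<bullet> (A *v w) = w \<bullet> (A *v u)"
  by (metis assms dot_lmul_matrix inner_commute vector_transpose_matrix)

lemma quadratic_form_add:
  fixes A :: "real^'n^'n"
  assumes "transpose A = A"
  shows "(u + t *\<^sub>R w) \<bullet> (A *v (u + t *\<^sub>R w)) =
         u \<bullet> (A *v u) + 2 * t * (w \<bullet> (A *v u)) + t\<^sup>2 * (w \<bullet> (A *v w))"
proof -
  have "(u + t *\<^sub>R w) \<bullet> (A *v (u + t *\<^sub>R w)) =
      u \<bullet> (A *v u) + t * (u \<bullet> (A *v w)) + t * (w \<bullet> (A *v u)) + t * t * (w \<bullet> (A *v w))"
    by (simp add: matrix_vector_right_distrib matrix_vector_mult_scaleR inner_left_distrib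
        inner_right_distrib algebra_simps)
  then show ?thesis
    using inner_matrix_symmetric[OF assms, of u w] by (simp add: power2_eq_square)
qed

text \<open>
  The first-order condition at a minimum, in algebraic form: near \<open>t = 0\<close> the linear term dominates.
\<close>

lemma linear_le_quadratic_imp_zero:
  fixes a b :: real
  assumes "\<And>t. 0 \<le> 2 * t * a + t\<^sup>2 * b"
  shows "a = 0"
proof (rule ccontr)
  assume "a \<noteq> 0"
  have b: "0 \<le> b" using assms[of 1] assms[of "-1"] by simp
  \<comment> \<open>A point close to the minimiser \<open>- a / b\<close> of the quadratic, defined also for \<open>b = 0\<close>.\<close>
  have "0 \<le> 2 * (- a / (b + 1)) * a + (- a / (b + 1))\<^sup>2 * b" by (rule assms)
  also have "\<dots> = a\<^sup>2 / (b+1)\<^sup>2 * (b - 2 * (b + 1))"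
    using b by (simp add: divide_simps power2_eq_square) (simp add: algebra_simps)
  also have "\<dots> < 0"
    using \<open>a \<noteq> 0\<close> b by (intro mult_pos_neg) auto
  finally show False by simp
qed

text \<open>
  A maximiser \<open>u\<close> of the generalised Rayleigh quotient \<open>(w \<bullet> A w) / (w \<bullet> P w)\<close> over the
  \<open>P\<close>-orthogonal complement \<open>W\<close> of the vectors found so far is the next eigenvector: with \<open>r\<close> the
  maximal value, \<open>N = r P - A\<close> is positive semidefinite on \<open>W\<close> and has \<open>u\<close> as a zero of its
  quadratic form, so \<open>N u\<close> is orthogonal to \<open>W\<close>; it is orthogonal to the earlier eigenvectors
  because these are eigenvectors, and together they span everything.
\<close>

lemma generalized_eigenvector_exists:
  fixes A P :: "real^'n^'n" and v :: "'i \<Rightarrow> real^'n"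
  assumes A: "transpose A = A" and P: "symmetric_pos_def P"
    and S: "finite S" "card S < CARD('n)"
    and eig: "\<And>i. i \<in> S \<Longrightarrow> A *v v i = c i *\<^sub>R (P *v v i)"
    and orth: "\<And>i j. i \<in> S \<Longrightarrow> j \<in> S \<Longrightarrow> v i \<bullet> (P *v v j) = (if i = j then 1 else 0)"
  obtains u r where "A *v u = r *\<^sub>R (P *v u)" "u \<bullet> (P *v u) = 1"
    "\<And>i. i \<in> S \<Longrightarrow> u \<bullet> (P *v v i) = 0"
proof -
  have sP: "transpose P = P" and pP: "\<And>w. w \<noteq> 0 \<Longrightarrow> w \<bullet> (P *v w) > 0"
    using P by (auto simp: symmetric_pos_def_def)
  define W where "W = {w. \<forall>i\<in>S. w \<bullet> (P *v v i) = 0}"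
  define X where "X = W \<inter> sphere 0 1"
  define q where "q w = (w \<bullet> (A *v w)) / (w \<bullet> (P *v w))" for w
  have "dim ((\<lambda>i. P *v v i) ` S) \<le> card ((\<lambda>i. P *v v i) ` S)"
    by (rule dim_le_card') (simp add: S)
  also have "\<dots> \<le> card S" by (rule card_image_le[OF S(1)])
  finally have "dim ((\<lambda>i. P *v v i) ` S) < DIM(real^'n)" using S by simp
  from orthogonal_to_subspace_exists[OF this] obtain w0 where
    w0: "w0 \<noteq> 0" "\<And>y. y \<in> span ((\<lambda>i. P *v v i) ` S) \<Longrightarrow> orthogonal w0 y" by metis
  have "w0 \<in> W"
    unfolding W_def using w0(2) by (simp add: orthogonal_def span_base)
  then have "(1 / norm w0) *\<^sub>R w0 \<in> X" using w0(1) by (auto simp: X_def W_def)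
  then have ne: "X \<noteq> {}" by auto
  have "closed W"
  proof -
    have "W = (\<Inter>i\<in>S. {w. w \<bullet> (P *v v i) = 0})" by (auto simp: W_def)
    moreover have "closed {w. w \<bullet> (P *v v i) = 0}" for i
      by (intro closed_Collect_eq continuous_intros)
    ultimately show ?thesis by auto
  qed
  then have cpt: "compact X" unfolding X_def by (simp add: closed_Int_compact)
  have cont: "continuous_on X q"
    unfolding q_def
  proof (intro continuous_intros ballI)
    fix w assume "w \<in> X"
    then have "w \<noteq> 0" by (auto simp: X_def)
    then show "w \<bullet> (P *v w) \<noteq> 0" using pP by force
  qed
  \<comment> \<open>Normalising in the Euclidean norm rather than by \<open>P\<close> makes the search region visibly compact.\<close>
  obtain u where u: "u \<in> X" and max: "\<And>w. w \<in> X \<Longrightarrow> q w \<le> q u"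
    using continuous_attains_sup[OF cpt ne cont] by auto
  have uW: "u \<in> W" and u0: "u \<noteq> 0" using u by (auto simp: X_def)
  define r where "r = q u"
  define N where "N = r *\<^sub>R P - A"
  have sN: "transpose N = N"
    using A sP by (simp add: N_def transpose_def vec_eq_iff)
  have Nv: "N *v w = r *\<^sub>R (P *v w) - A *v w" for w
    by (simp add: N_def matrix_vector_mult_diff_rdistrib scaleR_matrix_vector_assoc)
  have Nu: "u \<bullet> (N *v u) = 0"
    using pP[OF u0] by (simp add: Nv inner_diff_right r_def q_def)
  have Nnonneg: "0 \<le> w \<bullet> (N *v w)" if "w \<in> W" for w
  proof (cases "w = 0")
    case False
    have "(1 / norm w) *\<^sub>R w \<in> X" using that False by (auto simp: X_def W_def)
    from max[OF this] have "q w \<le> r"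
      using False by (simp add: q_def r_def matrix_vector_mult_scaleR)
    then show ?thesis
      using pP[OF False] by (simp add: Nv inner_diff_right q_def field_simps)
  qed simp
  have NW: "w \<bullet> (N *v u) = 0" if "w \<in> W" for w
  proof (rule linear_le_quadratic_imp_zero)
    fix t :: real
    have "u + t *\<^sub>R w \<in> W" using uW that by (auto simp: W_def inner_left_distrib)
    from Nnonneg[OF this] show "0 \<le> 2 * t * (w \<bullet> (N *v u)) + t\<^sup>2 * (w \<bullet> (N *v w))"
      by (simp add: quadratic_form_add[OF sN] Nu)
  qed
  have Nv0: "v i \<bullet> (N *v u) = 0" if "i \<in> S" for i
  proof -
    have "v i \<bullet> (N *v u) = u \<bullet> (N *v v i)" by (rule inner_matrix_symmetric[OF sN])
    also have "\<dots> = 0" using uW that by (simp add: Nv eig W_def inner_diff_right)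
    finally show ?thesis .
  qed
  \<comment> \<open>Split \<open>z\<close> into its \<open>P\<close>-projection on the \<open>v i\<close> and a remainder in \<open>W\<close>.\<close>
  have "z \<bullet> (N *v u) = 0" for z
  proof -
    define p where "p = (\<Sum>i\<in>S. (z \<bullet> (P *v v i)) *\<^sub>R v i)"
    have "z - p \<in> W"
      using S(1) by (auto simp: W_def p_def inner_diff_left inner_sum_left orth if_distrib
          cong: if_cong)
    moreover have "p \<bullet> (N *v u) = 0"
      by (simp add: p_def inner_sum_left Nv0)
    ultimately show ?thesis using NW[of "z - p"] by (simp add: inner_diff_left)
  qed
  then have "N *v u = 0" using inner_eq_zero_iff by blast
  then have eu: "A *v u = r *\<^sub>R (P *v u)" by (simp add: Nv)
  define k where "k = 1 / sqrt (u \<bullet> (P *v u))"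
  have "k * k * (u \<bullet> (P *v u)) = 1"
    using pP[OF u0] by (simp add: k_def)
  then show ?thesis
    using eu uW by (intro that[of "k *\<^sub>R u" r])
      (auto simp: matrix_vector_mult_scaleR W_def)
qed

text \<open>
  In the coordinates given by \<open>v\<close> the form of \<open>P\<close> is the identity and that of \<open>A\<close> is diagonal.
  Trace and determinant of \<open>P\<^sup>-\<^sup>1 A\<close> are read off from these coordinates, so that no matrix square
  root is ever taken.
\<close>

lemma simultaneous_diagonalization:
  fixes A P :: "real^'n^'n"
  assumes A: "transpose A = A" and P: "symmetric_pos_def P"
  obtains v :: "'n \<Rightarrow> real^'n" and c :: "'n \<Rightarrow> real" where
    "\<And>i. A *v v i = c i *\<^sub>R (P *v v i)"
    "\<And>i j. v i \<bullet> (P *v v j) = (if i = j then 1 else 0)"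
proof -
  have "\<exists>(v :: 'n \<Rightarrow> real^'n) c. (\<forall>i\<in>S. A *v v i = c i *\<^sub>R (P *v v i)) \<and>
      (\<forall>i\<in>S. \<forall>j\<in>S. v i \<bullet> (P *v v j) = (if i = j then 1 else 0))" for S :: "'n set"
    using finite[of S]
  proof (induction S rule: finite_induct)
    case (insert k S)
    then obtain v :: "'n \<Rightarrow> real^'n" and c where
      eig: "\<forall>i\<in>S. A *v v i = c i *\<^sub>R (P *v v i)" and
      orth: "\<forall>i\<in>S. \<forall>j\<in>S. v i \<bullet> (P *v v j) = (if i = j then 1 else 0)"
      by blast
    have "card (insert k S) \<le> CARD('n)" by (intro card_mono) auto
    then have "card S < CARD('n)" using insert by simp
    then obtain u r where u: "A *v u = r *\<^sub>R (P *v u)" "u \<bullet> (P *v u) = 1"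
      "\<And>i. i \<in> S \<Longrightarrow> u \<bullet> (P *v v i) = 0"
      using generalized_eigenvector_exists[OF A P insert(1), of v c] eig orth by metis
    have u': "v i \<bullet> (P *v u) = 0" if "i \<in> S" for i
      using u(3)[OF that] inner_matrix_symmetric[of P "v i" u] P
      by (simp add: symmetric_pos_def_def)
    have "(\<forall>i\<in>insert k S. A *v (v(k := u)) i = (c(k := r)) i *\<^sub>R (P *v (v(k := u)) i)) \<and>
      (\<forall>i\<in>insert k S. \<forall>j\<in>insert k S.
        (v(k := u)) i \<bullet> (P *v (v(k := u)) j) = (if i = j then 1 else 0))"
      using eig orth u u' insert(2) by auto
    then show ?case by blast
  qed auto
  from this[of UNIV] show ?thesis using that by auto
qed

section \<open>The log-determinant divergence and the BFGS update\<close>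

lemma outer_mult_vector: "outer u w *v z = (w \<bullet> z) *\<^sub>R u"
  by (simp add: vec_eq_iff outer_def matrix_vector_mult_def inner_vec_def sum_distrib_left
      mult.assoc mult.commute mult.left_commute)

lemma transpose_outer: "transpose (outer u w) = outer w u"
  by (simp add: vec_eq_iff outer_def transpose_def mult.commute)

lemma matrix_mult_outer: "A ** outer u w = outer (A *v u) w"
  by (simp add: matrix_eq outer_mult_vector matrix_vector_mult_scaleR
      flip: matrix_vector_mul_assoc)

lemma outer_mult_matrix: "outer u w ** A = outer u (transpose A *v w)"
  by (simp add: matrix_eq outer_mult_vector flip: matrix_vector_mul_assoc)
    (metis dot_lmul_matrix inner_commute vector_transpose_matrix transpose_transpose)

lemma trace_outer: "trace (outer u w) = u \<bullet> w"
  by (simp add: trace_def outer_def inner_vec_def)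

lemma trace_scaleR: "trace (r *\<^sub>R A) = r * trace (A :: real^'n^'n)"
  by (simp add: trace_def sum_distrib_left)

text \<open>
  A rotation turns \<open>w\<close> into a multiple of a coordinate vector. The rank-one perturbation then only
  changes one column of the identity, and Cramer's rule evaluates the determinant.
\<close>

lemma det_mat_1_plus_outer:
  fixes u w :: "real^'n"
  shows "det (mat 1 + outer u w) = 1 + u \<bullet> w"
proof -
  fix k :: 'n
  have "norm w = norm (norm w *\<^sub>R axis k 1 :: real^'n)" by (simp add: norm_axis_1)
  from orthogonal_transformation_exists[OF this]
  obtain F :: "real^'n \<Rightarrow> real^'n"
    where F: "orthogonal_transformation F" "F w = norm w *\<^sub>R axis k 1"
    by blast
  define R where "R = matrix F"
  have lF: "linear F" using F(1) by (rule orthogonal_transformation_linear)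
  have Rw: "R *v z = F z" for z
    using lF by (simp add: R_def matrix_works linear_linear)
  have "orthogonal_matrix R"
    using F(1) by (simp add: R_def orthogonal_transformation_matrix)
  then have RR: "R ** transpose R = mat 1" "transpose R ** R = mat 1"
    by (auto simp: orthogonal_matrix_def)
  define c where "c = norm w *\<^sub>R (R *v u)"
  have "det (mat 1 + outer u w) = det R * det (mat 1 + outer u w) * det (transpose R)"
    using RR(1) det_mul[of R "transpose R"] by (simp add: algebra_simps)
  also have "\<dots> = det (R ** (mat 1 + outer u w) ** transpose R)"
    by (simp add: det_mul)
  also have "R ** (mat 1 + outer u w) ** transpose R = mat 1 + outer c (axis k 1)"
  proof -
    have "w \<bullet> (transpose R *v z) = norm w * (axis k 1 \<bullet> z)" for z
    proof -
      have "w \<bullet> (transpose R *v z) = (R *v w) \<bullet> z"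
        by (metis dot_lmul_matrix transpose_matrix_vector transpose_transpose)
      then show ?thesis by (simp add: Rw[of w] F(2))
    qed
    moreover have "R *v (transpose R *v z) = z" for z
      using RR(1) by (simp only: matrix_vector_mul_assoc matrix_vector_mul_lid)
    ultimately show ?thesis
      by (simp add: matrix_eq matrix_vector_mult_add_rdistrib matrix_vector_right_distrib
          outer_mult_vector matrix_vector_mult_scaleR c_def mult.commute
          del: transpose_matrix_vector flip: matrix_vector_mul_assoc)
  qed
  also have "\<dots> = (\<chi> i j. if j = k then (mat 1 *v (axis k 1 + c)) $ i else (mat 1 :: real^'n^'n) $ i $ j)"
    unfolding matrix_vector_mul_lid by (auto simp: vec_eq_iff outer_def axis_def mat_def)
  also have "det \<dots> = (axis k 1 + c) $ k * det (mat 1 :: real^'n^'n)"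
    by (rule cramer_lemma)
  also have "\<dots> = 1 + c $ k" by simp
  also have "c $ k = (R *v u) \<bullet> (R *v w)"
    by (simp add: c_def Rw[of w] F(2) inner_axis)
  also have "\<dots> = u \<bullet> w"
    using F(1) by (simp add: Rw orthogonal_transformation_def)
  finally show ?thesis .
qed

lemma symmetric_pos_def_inverse:
  fixes P :: "real^'n^'n"
  assumes "symmetric_pos_def P"
  shows "matrix_inv P ** P = mat 1" "P ** matrix_inv P = mat 1"
    "matrix_inv P *v (P *v z) = z" "P *v (matrix_inv P *v z) = z"
    "z \<noteq> 0 \<Longrightarrow> z \<bullet> (matrix_inv P *v z) > 0"
proof -
  have pos: "\<And>w. w \<noteq> 0 \<Longrightarrow> w \<bullet> (P *v w) > 0"
    using assms by (auto simp: symmetric_pos_def_def)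
  have "\<forall>w. P *v w = 0 \<longrightarrow> w = 0" using pos by force
  then have "invertible P"
    using invertible_left_inverse matrix_left_invertible_ker by blast
  then have "\<exists>Q. P ** Q = mat 1 \<and> Q ** P = mat 1" by (simp add: invertible_def)
  then have "P ** matrix_inv P = mat 1 \<and> matrix_inv P ** P = mat 1"
    unfolding matrix_inv_def by (rule someI_ex)
  then show 1: "matrix_inv P ** P = mat 1" "P ** matrix_inv P = mat 1" by auto
  then show 2: "matrix_inv P *v (P *v z) = z" "P *v (matrix_inv P *v z) = z" for z
    by (simp_all add: matrix_vector_mul_assoc)
  assume "z \<noteq> 0"
  then have "matrix_inv P *v z \<noteq> 0" using 2(2)[of z] by auto
  from pos[OF this] show "z \<bullet> (matrix_inv P *v z) > 0"
    by (simp add: 2 inner_commute)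
qed

text \<open>
  The Bregman divergence of \<open>- ln det\<close>, also known as Stein's loss. Through \<open>trace\<close> and \<open>det\<close> it
  is the quantity \<open>tr X - d - ln det X\<close> at \<open>X = P\<^sup>-\<^sup>1\<^sup>/\<^sup>2 B P\<^sup>-\<^sup>1\<^sup>/\<^sup>2\<close>.
\<close>

definition logdet_divergence :: "real^'n^'n \<Rightarrow> real^'n^'n \<Rightarrow> real" where
  "logdet_divergence B P = trace (matrix_inv P ** B) - real CARD('n) - ln (det B / det P)"

lemma generalized_eigenvalues:
  fixes A P :: "real^'n^'n"
  assumes A: "transpose A = A" and P: "symmetric_pos_def P"
  obtains v c where "\<And>i. v i \<bullet> (A *v v i) = c i" "\<And>i. v i \<bullet> (P *v v i) = 1"
    "trace (matrix_inv P ** A) = (\<Sum>i\<in>(UNIV :: 'n set). c i)"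
    "det A = det P * (\<Prod>i\<in>(UNIV :: 'n set). c i)"
proof (rule simultaneous_diagonalization[OF A P])
  fix v :: "'n \<Rightarrow> real^'n" and c
  assume eig: "\<And>i. A *v v i = c i *\<^sub>R (P *v v i)"
    and orth: "\<And>i j. v i \<bullet> (P *v v j) = (if i = j then 1 else 0)"
  define V :: "real^'n^'n" where "V = (\<chi> i j. v j $ i)"
  define D :: "real^'n^'n" where "D = (\<chi> i j. if i = j then c i else 0)"
  have entry: "(Z ** V) $ i $ j = (Z *v v j) $ i" for Z :: "real^'n^'n" and i j
    by (simp add: V_def matrix_matrix_mult_def matrix_vector_mult_def)
  have "(transpose V ** (P ** V)) $ i $ j = v i \<bullet> (P *v v j)" for i j
  proof -
    have "transpose V $ i $ k = v i $ k" for k by (simp add: V_def transpose_def)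
    then show ?thesis
      by (simp add: matrix_matrix_mult_def[of "transpose V"] entry inner_vec_def)
  qed
  then have "transpose V ** (P ** V) = mat 1"
    using orth by (simp add: vec_eq_iff mat_def)
  then have inv: "(transpose V ** P) ** V = mat 1" by (simp add: matrix_mul_assoc)
  then have detV: "det V \<noteq> 0" by (metis det_I det_mul mult_zero_right zero_neq_one)
  have AV: "A ** V = P ** V ** D"
  proof -
    have "(X ** D) $ i $ j = c j * X $ i $ j" for X :: "real^'n^'n" and i j
      by (simp add: matrix_matrix_mult_def D_def if_distrib cong: if_cong)
    then have "(P ** V ** D) $ i $ j = (A ** V) $ i $ j" for i j
      by (simp add: entry eig)
    then show ?thesis by (simp add: vec_eq_iff)
  qed
  have "det A * det V = det P * det D * det V"
    using AV by (metis det_mul mult.assoc mult.commute)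
  then have 1: "det A = det P * (\<Prod>i\<in>UNIV. c i)"
    using detV by (simp add: det_diagonal D_def)
  have VV: "V ** (transpose V ** P) = mat 1"
    using inv by (simp add: matrix_left_right_inverse)
  have "matrix_inv P ** A = matrix_inv P ** (A ** V) ** (transpose V ** P)"
    by (metis VV matrix_mul_assoc matrix_mul_rid)
  also have "\<dots> = V ** (D ** (transpose V ** P))"
    unfolding AV by (simp add: matrix_mul_assoc symmetric_pos_def_inverse[OF P])
  finally have "trace (matrix_inv P ** A) = trace (D ** (transpose V ** P) ** V)"
    by (metis trace_mul_sym)
  also have "\<dots> = trace D" using inv by (simp add: matrix_mul_assoc[symmetric])
  also have "\<dots> = (\<Sum>i\<in>UNIV. c i)" by (simp add: trace_def D_def)
  finally have 2: "trace (matrix_inv P ** A) = (\<Sum>i\<in>UNIV. c i)" .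
  show ?thesis
    using that[of v c] 1 2 eig orth by simp
qed

lemma det_pos_of_symmetric_pos_def:
  fixes A :: "real^'n^'n"
  assumes "symmetric_pos_def A"
  shows "det A > 0"
proof -
  have I: "symmetric_pos_def (mat 1 :: real^'n^'n)"
    by (simp add: symmetric_pos_def_def transpose_mat)
  have A: "transpose A = A" and pos: "\<And>w. w \<noteq> 0 \<Longrightarrow> w \<bullet> (A *v w) > 0"
    using assms by (auto simp: symmetric_pos_def_def)
  obtain v c where v: "\<And>i. v i \<bullet> (A *v v i) = c i" "\<And>i. v i \<bullet> (mat 1 *v v i) = 1"
    and det: "det A = det (mat 1 :: real^'n^'n) * (\<Prod>i\<in>(UNIV :: 'n set). c i)"
    using generalized_eigenvalues[OF A I] by metis
  have "c i > 0" for i using v[of i] pos[of "v i"] by force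
  then show ?thesis using det by (simp add: prod_pos)
qed

text \<open>
  The divergence splits into scalar contributions \<open>c - 1 - ln c\<close>, one for each generalised
  eigenvalue, and each of these is nonnegative.
\<close>

lemma logdet_divergence_eigenvalues:
  fixes B P :: "real^'n^'n"
  assumes B: "symmetric_pos_def B" and P: "symmetric_pos_def P"
  obtains v c where "\<And>i. v i \<bullet> (B *v v i) = c i" "\<And>i. v i \<bullet> (P *v v i) = 1" "\<And>i. c i > 0"
    "logdet_divergence B P = (\<Sum>i\<in>(UNIV :: 'n set). c i - 1 - ln (c i))"
proof -
  have sB: "transpose B = B" and pB: "\<And>w. w \<noteq> 0 \<Longrightarrow> w \<bullet> (B *v w) > 0"
    using B by (auto simp: symmetric_pos_def_def)
  obtain v c where v: "\<And>i. v i \<bullet> (B *v v i) = c i" "\<And>i. v i \<bullet> (P *v v i) = 1"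
    and tr: "trace (matrix_inv P ** B) = (\<Sum>i\<in>(UNIV :: 'n set). c i)"
    and det: "det B = det P * (\<Prod>i\<in>(UNIV :: 'n set). c i)"
    using generalized_eigenvalues[OF sB P] by metis
  have c: "c i > 0" for i using v[of i] pB[of "v i"] by force
  have "ln (det B / det P) = (\<Sum>i\<in>UNIV. ln (c i))"
    using det det_pos_of_symmetric_pos_def[OF P] c by (simp add: ln_prod less_imp_neq[THEN not_sym])
  then have "logdet_divergence B P = (\<Sum>i\<in>(UNIV :: 'n set). c i - 1 - ln (c i))"
    by (simp add: logdet_divergence_def tr sum_subtractf)
  with v c show ?thesis using that by blast
qed

lemma logdet_divergence_nonneg:
  assumes "symmetric_pos_def B" "symmetric_pos_def P"
  shows "logdet_divergence B P \<ge> 0"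
proof (rule logdet_divergence_eigenvalues[OF assms])
  fix c
  assume "\<And>i. c i > 0" "logdet_divergence B P = (\<Sum>i\<in>UNIV. c i - 1 - ln (c i))"
  moreover have "0 \<le> c i - 1 - ln (c i)" for i
    using ln_le_minus_one[of "c i"] calculation(1)[of i] by simp
  ultimately show ?thesis by (simp add: sum_nonneg)
qed

text \<open>
  The generalised eigenvalues lie between \<open>lo\<close> and \<open>hi\<close>; each one is bounded above in its linear
  part and below in its logarithm.
\<close>

lemma logdet_divergence_le:
  fixes B P :: "real^'n^'n"
  assumes "symmetric_pos_def B" "symmetric_pos_def P" "lo > 0"
    and lo: "\<And>w. lo * (w \<bullet> (P *v w)) \<le> w \<bullet> (B *v w)"
    and hi: "\<And>w. w \<bullet> (B *v w) \<le> hi * (w \<bullet> (P *v w))"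
  shows "logdet_divergence B P \<le> real CARD('n) * (hi - 1 - ln lo)"
proof (rule logdet_divergence_eigenvalues[OF assms(1,2)])
  fix v c
  assume v: "\<And>i. v i \<bullet> (B *v v i) = c i" "\<And>i. v i \<bullet> (P *v v i) = 1"
    and eq: "logdet_divergence B P = (\<Sum>i\<in>(UNIV :: 'n set). c i - 1 - ln (c i))"
  have "c i - 1 - ln (c i) \<le> hi - 1 - ln lo" for i
  proof -
    have "lo \<le> c i" "c i \<le> hi" using lo[of "v i"] hi[of "v i"] v[of i] by auto
    moreover have "ln lo \<le> ln (c i)" using \<open>lo > 0\<close> calculation by simp
    ultimately show ?thesis by simp
  qed
  then show ?thesis
    unfolding eq using sum_bounded_above[of UNIV "\<lambda>i. c i - 1 - ln (c i)" "hi - 1 - ln lo"] by simp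
qed

text \<open>
  The update is a congruence by a rank-one perturbation of the identity. This one factorisation gives
  both that positive definiteness is inherited and what the determinant is. The vector \<open>u\<close> is found
  by requiring \<open>B s + (s \<bullet> B s) u\<close> to be a multiple of \<open>y\<close> and comparing the coefficient of
  \<open>y y\<^sup>T\<close>.
\<close>

lemma bfgs_update_eq_congruence:
  fixes B :: "real^'n^'n"
  assumes B: "symmetric_pos_def B" and "s \<noteq> 0" and sy: "s \<bullet> y > 0"
  defines "u \<equiv> (1 / (s \<bullet> (B *v s))) *\<^sub>R (sqrt (s \<bullet> (B *v s) / (s \<bullet> y)) *\<^sub>R y - B *v s)"
  shows "bfgs_update B s y = (mat 1 + outer u s) ** B ** transpose (mat 1 + outer u s)"
proof -
  have sB: "transpose B = B" and p: "s \<bullet> (B *v s) > 0"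
    using B \<open>s \<noteq> 0\<close> by (auto simp: symmetric_pos_def_def)
  define b where "b = B *v s"
  define m where "m = s \<bullet> b"
  define a where "a = sqrt (m / (s \<bullet> y))"
  have m: "m > 0" using p by (simp add: m_def b_def)
  have a2: "a * a = m / (s \<bullet> y)" using m sy by (simp add: a_def)
  have u: "u = (1 / m) *\<^sub>R (a *\<^sub>R y - b)" by (simp add: u_def m_def b_def a_def)
  have Bs: "B *v s = b" and sBz: "s \<bullet> (B *v z) = b \<bullet> z" for z
    using inner_matrix_symmetric[OF sB, of s z] by (simp_all add: b_def inner_commute)
  have tr: "transpose (mat 1 + outer u s) = mat 1 + outer s u"
    using transpose_outer[of u s] by (simp add: vec_eq_iff transpose_def mat_def eq_commute)
  have "(mat 1 + outer u s) ** B ** transpose (mat 1 + outer u s) =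
      B + outer b u + outer u b + m *\<^sub>R outer u u"
    unfolding tr using Bs sBz m_def
    by (simp add: matrix_eq matrix_vector_mult_add_rdistrib matrix_vector_right_distrib
        matrix_vector_mult_scaleR outer_mult_vector inner_right_distrib scaleR_add_left scaleR_add_right
        add_ac mult.commute
        flip: matrix_vector_mul_assoc scaleR_matrix_vector_assoc)
  also have "\<dots> = bfgs_update B s y"
  proof -
    have upd: "bfgs_update B s y = B - (1 / m) *\<^sub>R outer b b + (1 / (s \<bullet> y)) *\<^sub>R outer y y"
      by (simp add: bfgs_update_def matrix_mult_outer outer_mult_matrix sB b_def m_def)
    have "b $ i * u $ j + u $ i * b $ j + m * (u $ i * u $ j) =
        - (b $ i * b $ j / m) + y $ i * y $ j / (s \<bullet> y)" for i j
    proof -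
      have "b $ i * u $ j + u $ i * b $ j + m * (u $ i * u $ j) =
          (a * a) * (y $ i * y $ j) / m - b $ i * b $ j / m"
        using m by (simp add: u field_simps)
      then show ?thesis using a2 m by simp
    qed
    then show ?thesis
      by (simp add: upd vec_eq_iff outer_def algebra_simps)
  qed
  finally show ?thesis ..
qed

lemma bfgs_update_pos_def_and_det:
  fixes B :: "real^'n^'n"
  assumes B: "symmetric_pos_def B" and "s \<noteq> 0" and sy: "s \<bullet> y > 0"
  shows "symmetric_pos_def (bfgs_update B s y)"
    and "det (bfgs_update B s y) = det B * (s \<bullet> y) / (s \<bullet> (B *v s))"
proof -
  define m where "m = s \<bullet> (B *v s)"
  define u where "u = (1 / m) *\<^sub>R (sqrt (m / (s \<bullet> y)) *\<^sub>R y - B *v s)"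
  define E where "E = mat 1 + outer u s"
  have sB: "transpose B = B" and pB: "\<And>w. w \<noteq> 0 \<Longrightarrow> w \<bullet> (B *v w) > 0"
    using B by (auto simp: symmetric_pos_def_def)
  have m: "m > 0" using pB \<open>s \<noteq> 0\<close> by (auto simp: m_def)
  have eq: "bfgs_update B s y = E ** B ** transpose E"
    unfolding E_def u_def m_def by (rule bfgs_update_eq_congruence[OF assms])
  have "det E = 1 + u \<bullet> s" by (simp add: E_def det_mat_1_plus_outer)
  also have "\<dots> = sqrt (m / (s \<bullet> y)) * (s \<bullet> y) / m"
    using m by (simp add: u_def inner_diff_right inner_commute[of _ s] diff_divide_distrib flip: m_def)
  finally have dE: "det E = sqrt (m / (s \<bullet> y)) * (s \<bullet> y) / m" .
  define a where "a = sqrt (m / (s \<bullet> y))"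
  have "a * a = m / (s \<bullet> y)" using m sy by (simp add: a_def)
  moreover have "det E * det E = (a * a) * ((s \<bullet> y) / m * ((s \<bullet> y) / m))"
    using dE by (simp add: a_def[symmetric])
  ultimately have "det E * det E = m / (s \<bullet> y) * ((s \<bullet> y) / m * ((s \<bullet> y) / m))"
    by simp
  also have "\<dots> = (s \<bullet> y) / m"
    using m sy by simp
  finally have dE2: "det E * det E = (s \<bullet> y) / m" .
  have "det (bfgs_update B s y) = det B * (det E * det E)"
    by (simp add: eq det_mul)
  then show "det (bfgs_update B s y) = det B * (s \<bullet> y) / (s \<bullet> (B *v s))"
    by (simp add: dE2 m_def)
  have "invertible (transpose E)"
    using dE m sy by (simp add: invertible_det_nz)
  then have "\<forall>w. transpose E *v w = 0 \<longrightarrow> w = 0"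
    using invertible_left_inverse matrix_left_invertible_ker by blast
  then have inj: "transpose E *v w \<noteq> 0" if "w \<noteq> 0" for w
    using that by blast
  have "w \<bullet> (bfgs_update B s y *v w) > 0" if "w \<noteq> 0" for w
  proof -
    have "w \<bullet> (bfgs_update B s y *v w) = (transpose E *v w) \<bullet> (B *v (transpose E *v w))"
      unfolding eq matrix_vector_mul_assoc[symmetric]
      by (metis dot_lmul_matrix transpose_matrix_vector)
    then show ?thesis using pB[OF inj[OF that]] by simp
  qed
  moreover have "transpose (bfgs_update B s y) = bfgs_update B s y"
    by (simp add: eq matrix_transpose_mul sB matrix_mul_assoc)
  ultimately show "symmetric_pos_def (bfgs_update B s y)"
    by (simp add: symmetric_pos_def_def)
qed

text \<open>
  The number \<open>w\<close> collects the terms that measure the quality of the step. In the trace the removed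
  rank-one matrix contributes \<open>- r\<close> and, after \<open>ln w\<close> is split off, the determinant contributes
  \<open>ln r\<close> for the same \<open>r = (b \<bullet> P\<^sup>-\<^sup>1 b) / (s \<bullet> b)\<close>; the bound \<open>ln r - r \<le> - 1\<close> removes this
  uncontrolled number from the estimate.
\<close>

lemma logdet_divergence_bfgs_update:
  fixes B P :: "real^'n^'n"
  assumes B: "symmetric_pos_def B" and P: "symmetric_pos_def P" and s: "s \<noteq> 0" and sy: "s \<bullet> y > 0"
  defines "b \<equiv> B *v s"
  defines "w \<equiv> (s \<bullet> b)\<^sup>2 / ((b \<bullet> (matrix_inv P *v b)) * (s \<bullet> y))"
  shows "logdet_divergence (bfgs_update B s y) P
      \<le> logdet_divergence B P + y \<bullet> (matrix_inv P *v y) / (s \<bullet> y) - 1 + ln w"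
proof -
  define Q where "Q = matrix_inv P"
  have sB: "transpose B = B" and m: "s \<bullet> b > 0"
    using B s by (auto simp: symmetric_pos_def_def b_def)
  have "b \<noteq> 0" using m by auto
  then have bQ: "b \<bullet> (Q *v b) > 0"
    unfolding Q_def using symmetric_pos_def_inverse(5)[OF P] by blast
  define r where "r = b \<bullet> (Q *v b) / (s \<bullet> b)"
  have r: "r > 0" using bQ m by (simp add: r_def)
  have lw: "ln w = 2 * ln (s \<bullet> b) - ln (b \<bullet> (Q *v b)) - ln (s \<bullet> y)"
    using m bQ sy by (simp add: w_def Q_def ln_div ln_mult power2_eq_square)
  have lr: "ln r = ln (b \<bullet> (Q *v b)) - ln (s \<bullet> b)" using m bQ by (simp add: r_def ln_div)
  have "bfgs_update B s y = B - (1 / (s \<bullet> b)) *\<^sub>R outer b b + (1 / (s \<bullet> y)) *\<^sub>R outer y y"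
    by (simp add: bfgs_update_def matrix_mult_outer outer_mult_matrix sB b_def)
  then have "Q ** bfgs_update B s y =
      Q ** B - (1 / (s \<bullet> b)) *\<^sub>R outer (Q *v b) b + (1 / (s \<bullet> y)) *\<^sub>R outer (Q *v y) y"
    by (simp add: matrix_eq matrix_vector_mult_add_rdistrib matrix_vector_mult_diff_rdistrib
        matrix_vector_right_distrib matrix_vector_mult_diff_distrib matrix_vector_mult_scaleR
        outer_mult_vector flip: matrix_vector_mul_assoc scaleR_matrix_vector_assoc)
  then have tr: "trace (Q ** bfgs_update B s y) = trace (Q ** B) - r + y \<bullet> (Q *v y) / (s \<bullet> y)"
    by (simp add: trace_add trace_sub trace_scaleR trace_outer r_def inner_commute)
  have dB: "det B > 0" and dP: "det P > 0" using det_pos_of_symmetric_pos_def B P by auto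
  have "det (bfgs_update B s y) / det P = (det B / det P) * ((s \<bullet> y) / (s \<bullet> b))"
    using bfgs_update_pos_def_and_det(2)[OF B s sy] by (simp add: b_def)
  moreover have "ln \<dots> = ln (det B / det P) + (ln (s \<bullet> y) - ln (s \<bullet> b))"
    using dB dP sy m by (subst ln_mult_pos) (auto simp: ln_div)
  ultimately have "logdet_divergence (bfgs_update B s y) P =
      logdet_divergence B P + y \<bullet> (Q *v y) / (s \<bullet> y) + ln w + (ln r - r)"
    using tr by (simp add: logdet_divergence_def Q_def lw lr)
  moreover have "ln r - r \<le> - 1" using ln_le_minus_one[OF r] by simp
  ultimately show "logdet_divergence (bfgs_update B s y) P
      \<le> logdet_divergence B P + y \<bullet> (matrix_inv P *v y) / (s \<bullet> y) - 1 + ln w"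
    by (simp add: Q_def)
qed

section \<open>Strongly convex functions with Lipschitz Hessian\<close>

locale smooth_strongly_convex =
  fixes f :: "real^'n \<Rightarrow> real" and g :: "real^'n \<Rightarrow> real^'n" and H :: "real^'n \<Rightarrow> real^'n^'n"
    and \<mu> L M :: real and xopt :: "real^'n"
  assumes derivatives: "has_gradient_hessian f g H"
    and \<mu>_pos: "\<mu> > 0" and strong_convexity: "strongly_convex \<mu> f"
    and L_pos: "L > 0" and gradient_lipschitz: "L-lipschitz_on UNIV g"
    and M_pos: "M > 0"
    and hessian_lipschitz: "\<And>u v. spectral_norm (H u - H v) \<le> M * norm (u - v)"
    and minimum: "\<And>u. f xopt \<le> f u"
begin

lemma DERIV_along_line:
  "((\<lambda>t. f (x + t *\<^sub>R v)) has_real_derivative g (x + t *\<^sub>R v) \<bullet> v) (at t)"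
proof -
  have "(f has_derivative (\<lambda>h. h \<bullet> g (x + t *\<^sub>R v))) (at (x + t *\<^sub>R v))"
    using derivatives by (simp add: has_gradient_hessian_def gderiv_def)
  moreover have "((\<lambda>t. x + t *\<^sub>R v) has_derivative (\<lambda>h. h *\<^sub>R v)) (at t)"
    by (auto intro!: derivative_eq_intros)
  ultimately have "((\<lambda>t. f (x + t *\<^sub>R v)) has_derivative (\<lambda>h. (h *\<^sub>R v) \<bullet> g (x + t *\<^sub>R v))) (at t)"
    by (rule has_derivative_compose[rotated])
  then show ?thesis
    by (simp add: has_field_derivative_def inner_commute mult.commute mult_commute_abs)
qed

lemma DERIV_gradient_along_line:
  "((\<lambda>t. g (x + t *\<^sub>R v) \<bullet> w) has_real_derivative w \<bullet> (H (x + t *\<^sub>R v) *v v)) (at t)"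
proof -
  have "(g has_derivative (\<lambda>h. H (x + t *\<^sub>R v) *v h)) (at (x + t *\<^sub>R v))"
    using derivatives by (simp add: has_gradient_hessian_def)
  moreover have "((\<lambda>t. x + t *\<^sub>R v) has_derivative (\<lambda>h. h *\<^sub>R v)) (at t)"
    by (auto intro!: derivative_eq_intros)
  ultimately have "((\<lambda>t. g (x + t *\<^sub>R v)) has_derivative (\<lambda>h. H (x + t *\<^sub>R v) *v (h *\<^sub>R v))) (at t)"
    by (rule has_derivative_compose[rotated])
  from has_derivative_inner_left[OF this, of w] show ?thesis
    by (simp add: has_field_derivative_def inner_commute matrix_vector_mult_scaleR
        mult.commute mult_commute_abs)
qed

lemma gradient_mean_value:
  "\<exists>t. 0 < t \<and> t < 1 \<and> (g (x + v) - g x) \<bullet> w = w \<bullet> (H (x + t *\<^sub>R v) *v v)"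
  using MVT2[of 0 1 "\<lambda>t. g (x + t *\<^sub>R v) \<bullet> w" "\<lambda>t. w \<bullet> (H (x + t *\<^sub>R v) *v v)"]
    DERIV_gradient_along_line by (auto simp: inner_diff_left)

lemma second_order_taylor:
  "\<exists>t. 0 < t \<and> t < 1 \<and> f (x + v) = f x + g x \<bullet> v + (v \<bullet> (H (x + t *\<^sub>R v) *v v)) / 2"
proof -
  define d where "d m = (if m = 0 then (\<lambda>t. f (x + t *\<^sub>R v))
      else if m = 1 then (\<lambda>t. g (x + t *\<^sub>R v) \<bullet> v)
      else (\<lambda>t. v \<bullet> (H (x + t *\<^sub>R v) *v v)))" for m :: nat
  have "\<forall>m t. m < 2 \<and> 0 \<le> t \<and> t \<le> 1 \<longrightarrow> (d m has_real_derivative d (Suc m) t) (at t)"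
    using DERIV_along_line DERIV_gradient_along_line by (auto simp: d_def less_Suc_eq numeral_2_eq_2)
  from Taylor[of 2 d "\<lambda>t. f (x + t *\<^sub>R v)" 0 1 0 1, OF _ _ this]
  have "\<exists>t. 0 < t \<and> t < 1 \<and> f (x + v) = (\<Sum>m<2. d m 0 / fact m) + d 2 t / fact 2"
    by (auto simp: d_def)
  then show ?thesis by (simp add: d_def numeral_2_eq_2)
qed

lemma hessian_lipschitz_bilinear:
  "\<bar>w \<bullet> (H u *v v) - w \<bullet> (H z *v v)\<bar> \<le> M * norm (u - z) * norm v * norm w"
proof -
  have "bounded_linear (\<lambda>v. (H u - H z) *v v)"
    by (rule matrix_vector_mul_bounded_linear)
  then have "norm ((H u - H z) *v v) \<le> spectral_norm (H u - H z) * norm v"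
    unfolding spectral_norm_def by (rule onorm)
  also have "\<dots> \<le> M * norm (u - z) * norm v"
    by (intro mult_right_mono hessian_lipschitz) simp
  finally have n: "norm ((H u - H z) *v v) \<le> M * norm (u - z) * norm v" .
  have "\<bar>w \<bullet> (H u *v v) - w \<bullet> (H z *v v)\<bar> = \<bar>w \<bullet> ((H u - H z) *v v)\<bar>"
    by (simp add: matrix_vector_mult_diff_rdistrib inner_diff_right)
  also have "\<dots> \<le> norm w * norm ((H u - H z) *v v)" by (rule Cauchy_Schwarz_ineq2)
  also have "\<dots> \<le> norm w * (M * norm (u - z) * norm v)"
    by (intro mult_left_mono n) simp
  finally show ?thesis by (simp add: mult_ac)
qed

text \<open>
  The mixed second difference is a value of the bilinear form of the Hessian at a nearby point. Its
  left-hand side is symmetric in \<open>v\<close> and \<open>w\<close>, which is what makes the Hessian symmetric.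
\<close>

lemma second_difference:
  "\<exists>z. norm (z - x) \<le> norm v + norm w \<and>
    f (x + v + w) - f (x + v) - f (x + w) + f x = w \<bullet> (H z *v v)"
proof -
  define \<phi> where "\<phi> t = f ((x + v) + t *\<^sub>R w) - f (x + t *\<^sub>R w)" for t
  have "(\<phi> has_real_derivative g ((x + v) + t *\<^sub>R w) \<bullet> w - g (x + t *\<^sub>R w) \<bullet> w) (at t)" for t
    unfolding \<phi>_def by (intro DERIV_diff DERIV_along_line)
  with MVT2[of 0 1 \<phi> "\<lambda>t. g ((x + v) + t *\<^sub>R w) \<bullet> w - g (x + t *\<^sub>R w) \<bullet> w"]
  obtain t where t: "0 < t" "t < 1"
    "\<phi> 1 - \<phi> 0 = g ((x + v) + t *\<^sub>R w) \<bullet> w - g (x + t *\<^sub>R w) \<bullet> w"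
    by auto
  obtain r where r: "0 < r" "r < 1"
    "(g ((x + t *\<^sub>R w) + v) - g (x + t *\<^sub>R w)) \<bullet> w = w \<bullet> (H (x + t *\<^sub>R w + r *\<^sub>R v) *v v)"
    using gradient_mean_value by blast
  have "norm (x + t *\<^sub>R w + r *\<^sub>R v - x) = norm (t *\<^sub>R w + r *\<^sub>R v)" by simp
  also have "\<dots> \<le> t * norm w + r * norm v"
    using norm_triangle_ineq[of "t *\<^sub>R w" "r *\<^sub>R v"] t r by simp
  also have "\<dots> \<le> norm v + norm w"
    using mult_left_le_one_le[of "norm w" t] mult_left_le_one_le[of "norm v" r] t r by simp
  finally have "norm (x + t *\<^sub>R w + r *\<^sub>R v - x) \<le> norm v + norm w" .
  moreover have "f (x + v + w) - f (x + v) - f (x + w) + f x = w \<bullet> (H (x + t *\<^sub>R w + r *\<^sub>R v) *v v)"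
    using t(3) r(3) by (simp add: \<phi>_def inner_diff_left add_ac)
  ultimately show ?thesis by blast
qed

text \<open>
  Shrinking the two increments by a common factor \<open>s\<close>, the points at which the Hessian is evaluated
  in the two readings of the second difference approach \<open>x\<close>, so by Lipschitz continuity the
  asymmetry at \<open>x\<close> is \<open>O(s)\<close>.
\<close>

lemma hessian_symmetric: "transpose (H x) = H x"
proof -
  have sym: "w \<bullet> (H x *v v) = v \<bullet> (H x *v w)" for v w
  proof -
    define K where "K = M * (norm v + norm w) * norm v * norm w"
    define \<delta> where "\<delta> = \<bar>w \<bullet> (H x *v v) - v \<bullet> (H x *v w)\<bar>"
    have le: "\<delta> \<le> 2 * (K * s)" if s: "s > 0" for s
    proof -
      obtain z where z: "norm (z - x) \<le> norm (s *\<^sub>R v) + norm (s *\<^sub>R w)"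
        "f (x + s *\<^sub>R v + s *\<^sub>R w) - f (x + s *\<^sub>R v) - f (x + s *\<^sub>R w) + f x
          = (s *\<^sub>R w) \<bullet> (H z *v (s *\<^sub>R v))" using second_difference by blast
      obtain y where y: "norm (y - x) \<le> norm (s *\<^sub>R w) + norm (s *\<^sub>R v)"
        "f (x + s *\<^sub>R w + s *\<^sub>R v) - f (x + s *\<^sub>R w) - f (x + s *\<^sub>R v) + f x
          = (s *\<^sub>R v) \<bullet> (H y *v (s *\<^sub>R w))" using second_difference by blast
      have "(s *\<^sub>R w) \<bullet> (H z *v (s *\<^sub>R v)) = (s *\<^sub>R v) \<bullet> (H y *v (s *\<^sub>R w))"
        using z(2) y(2) by (simp add: algebra_simps)
      then have eq: "w \<bullet> (H z *v v) = v \<bullet> (H y *v w)"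
        using s by (simp add: matrix_vector_mult_scaleR)
      have zx: "norm (z - x) \<le> s * (norm v + norm w)" and yx: "norm (y - x) \<le> s * (norm v + norm w)"
        using z(1) y(1) s by (simp_all add: algebra_simps)
      have "\<bar>w \<bullet> (H z *v v) - w \<bullet> (H x *v v)\<bar> \<le> M * norm (z - x) * norm v * norm w"
        by (rule hessian_lipschitz_bilinear)
      also have "\<dots> \<le> M * (s * (norm v + norm w)) * norm v * norm w"
        using M_pos by (intro mult_right_mono mult_left_mono zx) auto
      finally have 1: "\<bar>w \<bullet> (H z *v v) - w \<bullet> (H x *v v)\<bar> \<le> K * s"
        by (simp add: K_def mult_ac)
      have "\<bar>v \<bullet> (H y *v w) - v \<bullet> (H x *v w)\<bar> \<le> M * norm (y - x) * norm w * norm v"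
        by (rule hessian_lipschitz_bilinear)
      also have "\<dots> \<le> M * (s * (norm v + norm w)) * norm w * norm v"
        using M_pos by (intro mult_right_mono mult_left_mono yx) auto
      finally have 2: "\<bar>v \<bullet> (H y *v w) - v \<bullet> (H x *v w)\<bar> \<le> K * s"
        by (simp add: K_def mult_ac)
      show ?thesis using 1 2 eq unfolding \<delta>_def by linarith
    qed
    have "K \<ge> 0" using M_pos by (simp add: K_def)
    have "\<delta> \<le> 0 + e" if "e > 0" for e
    proof -
      have "\<delta> \<le> 2 * (K * (e / (2 * (K + 1))))" using \<open>K \<ge> 0\<close> that by (intro le) auto
      also have "\<dots> \<le> e" using \<open>K \<ge> 0\<close> that by (simp add: field_simps)
      finally show ?thesis by simp
    qed
    then have "\<delta> \<le> 0" by (rule field_le_epsilon)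
    then show ?thesis by (simp add: \<delta>_def)
  qed
  have "(transpose (H x) *v v) \<bullet> w = (H x *v v) \<bullet> w" for v w
    unfolding transpose_matrix_vector dot_lmul_matrix using sym[of v w]
    by (simp add: inner_commute)
  then have "transpose (H x) *v v = H x *v v" for v
    by (metis vector_eq_rdot)
  then show ?thesis by (simp add: matrix_eq del: transpose_matrix_vector)
qed

text \<open>
  Divide the convexity inequality for the point at parameter \<open>h\<close> by \<open>h\<close> and let \<open>h\<close> tend to zero.
\<close>

lemma strong_convexity_gradient:
  "f y \<ge> f x + g x \<bullet> (y - x) + \<mu> / 2 * (norm (y - x))\<^sup>2"
proof -
  define d where "d = y - x"
  have "((\<lambda>t. f (x + t *\<^sub>R d)) has_real_derivative g x \<bullet> d) (at 0)"
    using DERIV_along_line[of x d 0] by simp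
  then have "((\<lambda>h. (f (x + h *\<^sub>R d) - f x) / h) \<longlongrightarrow> g x \<bullet> d) (at 0)"
    by (simp add: DERIV_def)
  then have lim: "((\<lambda>h. (f (x + h *\<^sub>R d) - f x) / h) \<longlongrightarrow> g x \<bullet> d) (at_right 0)"
    by (rule filterlim_mono) (simp_all add: at_le)
  have lim2: "((\<lambda>h. f y - f x - \<mu> / 2 * (1 - h) * (norm d)\<^sup>2) \<longlongrightarrow>
      f y - f x - \<mu> / 2 * (1 - 0) * (norm d)\<^sup>2) (at_right 0)"
    by (intro tendsto_intros)
  have "eventually (\<lambda>h. (f (x + h *\<^sub>R d) - f x) / h \<le> f y - f x - \<mu> / 2 * (1 - h) * (norm d)\<^sup>2) (at_right 0)"
    unfolding eventually_at_right[OF zero_less_one]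
  proof (intro exI[of _ 1] conjI allI impI)
    fix h :: real assume h: "0 < h" "h < 1"
    have "f ((1 - h) *\<^sub>R x + h *\<^sub>R y) \<le> (1 - h) * f x + h * f y - \<mu> / 2 * h * (1 - h) * (norm (x - y))\<^sup>2"
      using strong_convexity h by (auto simp: strongly_convex_def)
    moreover have "(1 - h) *\<^sub>R x + h *\<^sub>R y = x + h *\<^sub>R d" by (simp add: d_def algebra_simps)
    ultimately have "f (x + h *\<^sub>R d) - f x \<le> h * (f y - f x - \<mu> / 2 * (1 - h) * (norm d)\<^sup>2)"
      by (simp add: d_def norm_minus_commute algebra_simps)
    then show "(f (x + h *\<^sub>R d) - f x) / h \<le> f y - f x - \<mu> / 2 * (1 - h) * (norm d)\<^sup>2"
      using h by (simp add: field_simps)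
  qed simp
  from tendsto_le[OF _ lim2 lim this] show ?thesis by (simp add: d_def)
qed

lemma gradient_strongly_monotone: "(g y - g x) \<bullet> (y - x) \<ge> \<mu> * (norm (y - x))\<^sup>2"
  using strong_convexity_gradient[of x y] strong_convexity_gradient[of y x]
  by (simp add: norm_minus_commute inner_diff_right inner_diff_left)

lemma hessian_bounds:
  shows "\<mu> * (v \<bullet> v) \<le> v \<bullet> (H x *v v)" and "v \<bullet> (H x *v v) \<le> L * (v \<bullet> v)"
proof -
  have "((\<lambda>t. g (x + t *\<^sub>R v) \<bullet> v) has_real_derivative v \<bullet> (H x *v v)) (at 0)"
    using DERIV_gradient_along_line[of x v v 0] by simp
  then have lim: "((\<lambda>h. (g (x + h *\<^sub>R v) - g x) \<bullet> v / h) \<longlongrightarrow> v \<bullet> (H x *v v)) (at 0)"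
    by (simp add: DERIV_def inner_diff_left)
  have bounds: "\<mu> * (v \<bullet> v) \<le> (g (x + h *\<^sub>R v) - g x) \<bullet> v / h \<and>
      (g (x + h *\<^sub>R v) - g x) \<bullet> v / h \<le> L * (v \<bullet> v)" if "h \<noteq> 0" for h
  proof -
    have eq: "(g (x + h *\<^sub>R v) - g x) \<bullet> v / h = (g (x + h *\<^sub>R v) - g x) \<bullet> (h *\<^sub>R v) / h\<^sup>2"
      using that by (simp add: power2_eq_square)
    have lo: "(g (x + h *\<^sub>R v) - g x) \<bullet> (h *\<^sub>R v) \<ge> \<mu> * (h\<^sup>2 * (v \<bullet> v))"
      using gradient_strongly_monotone[where y="x + h *\<^sub>R v" and x=x]
      by (simp add: power_mult_distrib power2_norm_eq_inner)
    have "dist (g (x + h *\<^sub>R v)) (g x) \<le> L * dist (x + h *\<^sub>R v) x"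
      using gradient_lipschitz by (rule lipschitz_onD) auto
    then have "norm (g (x + h *\<^sub>R v) - g x) \<le> L * norm (h *\<^sub>R v)" by (simp add: dist_norm)
    then have "norm (g (x + h *\<^sub>R v) - g x) * norm (h *\<^sub>R v) \<le> L * norm (h *\<^sub>R v) * norm (h *\<^sub>R v)"
      by (intro mult_right_mono) auto
    with norm_cauchy_schwarz[of "g (x + h *\<^sub>R v) - g x" "h *\<^sub>R v"]
    have hi: "(g (x + h *\<^sub>R v) - g x) \<bullet> (h *\<^sub>R v) \<le> L * norm (h *\<^sub>R v) * norm (h *\<^sub>R v)" by linarith
    have "norm (h *\<^sub>R v) * norm (h *\<^sub>R v) = h\<^sup>2 * (v \<bullet> v)"
      by (metis power2_norm_eq_inner power2_eq_square norm_scaleR power_mult_distrib power2_abs)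
    then have hi': "(g (x + h *\<^sub>R v) - g x) \<bullet> (h *\<^sub>R v) \<le> L * (h\<^sup>2 * (v \<bullet> v))"
      using hi by (simp only: mult.assoc)
    have "h\<^sup>2 > 0" using that by simp
    with hi' lo show ?thesis
      unfolding eq by (simp only: pos_le_divide_eq pos_divide_le_eq mult_ac simp_thms)
  qed
  have ev: "eventually (\<lambda>h. h \<noteq> 0) (at (0::real))" by (simp add: eventually_at_filter)
  show "\<mu> * (v \<bullet> v) \<le> v \<bullet> (H x *v v)"
    by (rule tendsto_lowerbound[OF lim]) (use ev bounds in \<open>auto elim: eventually_mono\<close>)
  show "v \<bullet> (H x *v v) \<le> L * (v \<bullet> v)"
    by (rule tendsto_upperbound[OF lim]) (use ev bounds in \<open>auto elim: eventually_mono\<close>)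
qed

lemma hessian_pos_def: "symmetric_pos_def (H x)"
proof -
  have "v \<bullet> (H x *v v) > 0" if "v \<noteq> 0" for v
    using hessian_bounds(1)[of v x] \<mu>_pos that
    by (smt (verit) inner_gt_zero_iff mult_pos_pos)
  then show ?thesis by (simp add: symmetric_pos_def_def hessian_symmetric)
qed

lemma gradient_xopt: "g xopt = 0"
proof -
  have "(f has_derivative (\<lambda>h. h \<bullet> g xopt)) (at xopt)"
    using derivatives by (simp add: has_gradient_hessian_def gderiv_def)
  then have "(\<lambda>h. h \<bullet> g xopt) = (\<lambda>h. 0)"
    by (rule differential_zero_maxmin[OF _ open_UNIV, rotated]) (auto simp: minimum)
  then show ?thesis by (metis inner_eq_zero_iff)
qed

lemma gap_ge: "f z - f xopt \<ge> \<mu> / 2 * (norm (z - xopt))\<^sup>2"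
  using strong_convexity_gradient[of xopt z] by (simp add: gradient_xopt)

lemma gap_pos: "g z \<noteq> 0 \<Longrightarrow> f z - f xopt > 0"
  using gap_ge[of z] gradient_xopt \<mu>_pos
  by (smt (verit) mult_pos_pos half_gt_zero zero_less_norm_iff zero_less_power right_minus_eq)

lemma segment_le:
  assumes "f z \<le> f x" "0 < t" "t < 1"
  shows "f (x + t *\<^sub>R (z - x)) \<le> f x"
proof -
  have "f ((1 - t) *\<^sub>R x + t *\<^sub>R z) \<le> (1 - t) * f x + t * f z - \<mu> / 2 * t * (1 - t) * (norm (x - z))\<^sup>2"
    using strong_convexity assms by (auto simp: strongly_convex_def)
  also have "\<dots> \<le> (1 - t) * f x + t * f z" using \<mu>_pos assms by simp
  also have "\<dots> \<le> (1 - t) * f x + t * f x" using assms by simp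
  finally show ?thesis by (simp add: algebra_simps)
qed

text \<open>
  On a sublevel set the distance to the minimiser is controlled by the gap, hence the Hessian differs
  from the one at the minimiser by at most \<open>C \<mu> I\<close>. As \<open>\<mu> I\<close> lies below every Hessian, this additive
  error may be charged to either of the two matrices and becomes the relative factor \<open>1 + C\<close>.
\<close>

lemma hessian_near_optimum:
  assumes "f z \<le> f x"
  shows "v \<bullet> (H z *v v) \<le> (1 + C_const M \<mu> f xopt x) * (v \<bullet> (H xopt *v v))"
    and "v \<bullet> (H xopt *v v) \<le> (1 + C_const M \<mu> f xopt x) * (v \<bullet> (H z *v v))"
proof -
  define C where "C = C_const M \<mu> f xopt x"
  define r where "r = norm (z - xopt)"
  have "C \<ge> 0" using M_pos minimum[of x] by (simp add: C_def C_const_def)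
  have pw: "\<mu> powr (3/2) = \<mu> * sqrt \<mu>"
    using \<mu>_pos powr_add[of \<mu> 1 "1/2"] by (simp add: powr_half_sqrt)
  have "\<mu> / 2 * r\<^sup>2 \<le> f x - f xopt"
    using gap_ge[of z] assms by (simp add: r_def)
  then have "\<mu> * r\<^sup>2 \<le> 2 * (f x - f xopt)" by simp
  then have "sqrt (\<mu> * r\<^sup>2) \<le> sqrt (2 * (f x - f xopt))" by (rule real_sqrt_le_mono)
  then have "sqrt \<mu> * r \<le> sqrt (2 * (f x - f xopt))"
    by (simp add: real_sqrt_mult r_def)
  then have "M * r \<le> M * (sqrt (2 * (f x - f xopt)) / sqrt \<mu>)"
    using M_pos \<mu>_pos by (simp add: field_simps)
  also have "\<dots> = C * \<mu>"
    using \<mu>_pos by (simp add: C_def C_const_def pw field_simps)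
  finally have Mr: "M * r \<le> C * \<mu>" .
  have "\<bar>v \<bullet> (H z *v v) - v \<bullet> (H xopt *v v)\<bar> \<le> M * r * (v \<bullet> v)"
    using hessian_lipschitz_bilinear[of v z v xopt]
    by (simp add: r_def power2_eq_square mult.assoc flip: power2_norm_eq_inner)
  also have "\<dots> \<le> C * \<mu> * (v \<bullet> v)" by (intro mult_right_mono Mr) simp
  finally have d: "\<bar>v \<bullet> (H z *v v) - v \<bullet> (H xopt *v v)\<bar> \<le> C * (\<mu> * (v \<bullet> v))"
    by (simp add: mult.assoc)
  have "C * (\<mu> * (v \<bullet> v)) \<le> C * (v \<bullet> (H y *v v))" for y
    by (intro mult_left_mono hessian_bounds) fact
  from this[of z] this[of xopt] d
  show "v \<bullet> (H z *v v) \<le> (1 + C_const M \<mu> f xopt x) * (v \<bullet> (H xopt *v v))"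
    and "v \<bullet> (H xopt *v v) \<le> (1 + C_const M \<mu> f xopt x) * (v \<bullet> (H z *v v))"
    unfolding C_def[symmetric] by (simp_all add: algebra_simps)
qed

text \<open>
  If the Hessian is at most \<open>K P\<close> along the step, then \<open>y\<close> is controlled in the norm dual to \<open>P\<close>.
  For the averaged Hessian \<open>G\<close> with \<open>y = G s\<close> this is \<open>G P\<^sup>-\<^sup>1 G \<le> K G\<close>. Averaging is avoided by
  applying the mean value theorem to a single functional of the gradient, chosen as in the proof of
  Cauchy--Schwarz: along \<open>(2 / K) z - s\<close> with \<open>z = P\<^sup>-\<^sup>1 y\<close>, the square of \<open>s - z / K\<close> in the form
  of the Hessian yields the estimate at every intermediate point. The hypothesis is local, so it also
  serves for weights that only dominate the Hessian near the minimiser.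
\<close>

lemma weighted_cocoercivity:
  assumes P: "symmetric_pos_def P" and K: "K > 0"
    and le: "\<And>t v. 0 < t \<Longrightarrow> t < 1 \<Longrightarrow> v \<bullet> (H (x + t *\<^sub>R s) *v v) \<le> K * (v \<bullet> (P *v v))"
  defines "y \<equiv> g (x + s) - g x"
  shows "y \<bullet> (matrix_inv P *v y) \<le> K * (s \<bullet> y)"
proof -
  define z where "z = matrix_inv P *v y"
  have Pz: "P *v z = y" by (simp add: z_def symmetric_pos_def_inverse(4)[OF P])
  obtain t where t: "0 < t" "t < 1"
    "(g (x + s) - g x) \<bullet> ((2 / K) *\<^sub>R z - s) = ((2 / K) *\<^sub>R z - s) \<bullet> (H (x + t *\<^sub>R s) *v s)"
    using gradient_mean_value by blast
  define A where "A = H (x + t *\<^sub>R s)"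
  have sA: "transpose A = A" by (simp add: A_def hessian_symmetric)
  have "0 \<le> (s + (- 1 / K) *\<^sub>R z) \<bullet> (A *v (s + (- 1 / K) *\<^sub>R z))"
    using hessian_bounds(1) \<mu>_pos unfolding A_def
    by (meson inner_ge_zero less_imp_le mult_nonneg_nonneg order_trans)
  also have "\<dots> = s \<bullet> (A *v s) + 2 * (- 1 / K) * (z \<bullet> (A *v s)) + (- 1 / K)\<^sup>2 * (z \<bullet> (A *v z))"
    by (rule quadratic_form_add[OF sA])
  finally have 1: "2 / K * (z \<bullet> (A *v s)) - s \<bullet> (A *v s) \<le> (1 / K)\<^sup>2 * (z \<bullet> (A *v z))"
    by (simp add: power2_eq_square)
  have "(1 / K)\<^sup>2 * (z \<bullet> (A *v z)) \<le> (1 / K)\<^sup>2 * (K * (z \<bullet> (P *v z)))"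
    using le[OF t(1,2)] by (intro mult_left_mono) (auto simp: A_def)
  also have "\<dots> = (z \<bullet> y) / K" using K by (simp add: Pz power2_eq_square)
  finally have "2 / K * (z \<bullet> (A *v s)) - s \<bullet> (A *v s) \<le> (z \<bullet> y) / K" using 1 by linarith
  moreover have "2 / K * (z \<bullet> (A *v s)) - s \<bullet> (A *v s) = 2 / K * (z \<bullet> y) - s \<bullet> y"
    using t(3) by (simp add: A_def y_def inner_diff_left inner_diff_right inner_commute)
  ultimately have "2 / K * (z \<bullet> y) - s \<bullet> y \<le> (z \<bullet> y) / K" by (simp only:)
  then have "z \<bullet> y \<le> K * (s \<bullet> y)" using K by (simp add: field_simps)
  then show ?thesis by (simp add: z_def inner_commute)
qed

text \<open>
  A Taylor expansion at \<open>x\<close> bounds the gap by \<open>- g x \<bullet> e - (e \<bullet> P e) / (2 K)\<close>, and completing the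
  square eliminates \<open>e\<close>. For \<open>P = I\<close> and \<open>K = 1 / \<mu>\<close> this is the Polyak--Lojasiewicz inequality.
\<close>

lemma weighted_gap_bound:
  assumes P: "symmetric_pos_def P" and K: "K > 0"
    and le: "\<And>t v. 0 < t \<Longrightarrow> t < 1 \<Longrightarrow>
      v \<bullet> (P *v v) \<le> K * (v \<bullet> (H (x + t *\<^sub>R (xopt - x)) *v v))"
  shows "f x - f xopt \<le> K / 2 * (g x \<bullet> (matrix_inv P *v g x))"
proof -
  define e where "e = xopt - x"
  define z where "z = matrix_inv P *v g x"
  have Pz: "P *v z = g x" by (simp add: z_def symmetric_pos_def_inverse(4)[OF P])
  have sP: "transpose P = P" using P by (simp add: symmetric_pos_def_def)
  obtain t where t: "0 < t" "t < 1"
    "f (x + e) = f x + g x \<bullet> e + (e \<bullet> (H (x + t *\<^sub>R e) *v e)) / 2"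
    using second_order_taylor by blast
  have 1: "e \<bullet> (P *v e) / K \<le> e \<bullet> (H (x + t *\<^sub>R e) *v e)"
    using le[OF t(1,2), of e] K by (simp add: e_def field_simps)
  have "0 \<le> (e + K *\<^sub>R z) \<bullet> (P *v (e + K *\<^sub>R z))"
    using P by (cases "e + K *\<^sub>R z = 0") (auto simp: symmetric_pos_def_def less_imp_le)
  also have "\<dots> = e \<bullet> (P *v e) + 2 * K * (z \<bullet> (P *v e)) + K\<^sup>2 * (z \<bullet> (P *v z))"
    by (rule quadratic_form_add[OF sP])
  also have "z \<bullet> (P *v e) = g x \<bullet> e"
    using inner_matrix_symmetric[OF sP, of z e] by (simp add: Pz inner_commute)
  finally have "0 \<le> (e \<bullet> (P *v e) + 2 * K * (g x \<bullet> e) + K\<^sup>2 * (z \<bullet> g x)) / K"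
    using K by (simp add: Pz)
  also have "\<dots> = e \<bullet> (P *v e) / K + 2 * (g x \<bullet> e) + K * (z \<bullet> g x)"
    using K by (simp add: add_divide_distrib power2_eq_square)
  finally have "f x - f (x + e) \<le> K / 2 * (z \<bullet> g x)"
    using 1 t(3) by simp
  then show ?thesis by (simp add: e_def z_def inner_commute)
qed

end

section \<open>Convergence of BFGS with an inexact line search\<close>

text \<open>
  The exponential lies above its tangent at \<open>- 1\<close>, so that \<open>e b \<ge> 2 + ln b\<close>. The
  tangent point is the worst case of equal logarithms, and \<open>e \<le> 3\<close> gives the constant of the rate.
\<close>

lemma sum_ge_third_of_sum_ln_ge:
  fixes b :: "nat \<Rightarrow> real"
  assumes pos: "\<And>i. i < t \<Longrightarrow> b i > 0" and ln: "(\<Sum>i<t. ln (b i)) \<ge> - real t"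
  shows "(\<Sum>i<t. b i) \<ge> real t / 3"
proof -
  have "2 + ln (b i) \<le> 3 * b i" if "i < t" for i
  proof -
    have "ln (exp 1 * b i) \<le> exp 1 * b i - 1"
      using pos[OF that] by (intro ln_le_minus_one) simp
    moreover have "ln (exp 1 * b i) = 1 + ln (b i)"
      using pos[OF that] by (simp add: ln_mult)
    moreover have "exp 1 * b i \<le> 3 * b i"
      using pos[OF that] exp_le by (intro mult_right_mono) auto
    ultimately show ?thesis by simp
  qed
  then have "(\<Sum>i<t. 2 + ln (b i)) \<le> (\<Sum>i<t. 3 * b i)" by (intro sum_mono) simp
  then show ?thesis using ln by (simp add: sum.distrib flip: sum_distrib_left)
qed

text \<open>
  Only the average of the contractions \<open>a i\<close> matters, since the logarithm of \<open>1 - a\<close> is concave: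
  \<open>1 - a\<close> lies below \<open>(1 - c) exp ((c - a) / (1 - c))\<close>, and in the product the exponents add up to
  something nonpositive.
\<close>

lemma contraction_product_le_power:
  fixes h a :: "nat \<Rightarrow> real"
  assumes step: "\<And>i. i < t \<Longrightarrow> h (Suc i) \<le> (1 - a i) * h i"
    and nonneg: "\<And>i. h i \<ge> 0" and c: "c < 1" and sum: "(\<Sum>i<t. a i) \<ge> real t * c"
  shows "h t \<le> (1 - c) ^ t * h 0"
proof -
  have one: "1 - r \<le> (1 - c) * exp ((c - r) / (1 - c))" for r
  proof -
    have "1 - r = (1 - c) * (1 + (c - r) / (1 - c))" using c by (simp add: field_simps)
    also have "\<dots> \<le> (1 - c) * exp ((c - r) / (1 - c))"
      using c exp_ge_add_one_self by (intro mult_left_mono) auto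
    finally show ?thesis .
  qed
  have "k \<le> t \<Longrightarrow> h k \<le> (1 - c) ^ k * exp ((\<Sum>i<k. c - a i) / (1 - c)) * h 0" for k
  proof (induction k)
    case (Suc k)
    have "h (Suc k) \<le> (1 - a k) * h k" using Suc.prems by (intro step) simp
    also have "\<dots> \<le> (1 - c) * exp ((c - a k) / (1 - c)) * h k"
      by (intro mult_right_mono one nonneg)
    also have "\<dots> \<le> (1 - c) * exp ((c - a k) / (1 - c)) *
        ((1 - c) ^ k * exp ((\<Sum>i<k. c - a i) / (1 - c)) * h 0)"
      using Suc c by (intro mult_left_mono) auto
    also have "\<dots> = (1 - c) ^ Suc k * exp ((\<Sum>i<Suc k. c - a i) / (1 - c)) * h 0"
      by (simp add: add_divide_distrib exp_add)
    finally show ?case .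
  qed simp
  then have "h t \<le> (1 - c) ^ t * exp ((\<Sum>i<t. c - a i) / (1 - c)) * h 0" by simp
  also have "\<dots> \<le> (1 - c) ^ t * 1 * h 0"
  proof (intro mult_right_mono mult_left_mono nonneg)
    have "(\<Sum>i<t. c - a i) \<le> 0" using sum by (simp add: sum_subtractf)
    then show "exp ((\<Sum>i<t. c - a i) / (1 - c)) \<le> 1"
      using c by (simp add: divide_nonpos_pos)
    show "0 \<le> (1 - c) ^ t" using c by simp
  qed
  finally show ?thesis by simp
qed

lemma scaled_identity_pos_def:
  assumes "c > 0"
  shows "symmetric_pos_def (c *\<^sub>R (mat 1 :: real^'n^'n))"
proof -
  have "transpose (c *\<^sub>R (mat 1 :: real^'n^'n)) = c *\<^sub>R mat 1"
    by (simp add: transpose_def mat_def vec_eq_iff)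
  then show ?thesis
    using assms by (simp add: symmetric_pos_def_def flip: scaleR_matrix_vector_assoc)
qed

locale bfgs_run = smooth_strongly_convex f g H \<mu> L M xopt
  for f :: "real^'n \<Rightarrow> real" and g H \<mu> L M xopt +
  fixes \<alpha> \<beta> :: real and \<eta> :: "nat \<Rightarrow> real" and x :: "nat \<Rightarrow> real^'n" and B :: "nat \<Rightarrow> real^'n^'n"
  assumes \<alpha>_pos: "0 < \<alpha>" and \<alpha>_less: "\<alpha> < 1/2" and \<beta>_pos: "0 < \<beta>" and \<beta>_less: "\<beta> < 1"
    and iterates: "bfgs_sequence g \<eta> x B"
    and line_search: "\<And>t. armijo_wolfe \<alpha> \<beta> f g (x t) (bfgs_direction (B t) (g (x t))) (\<eta> t)"
begin

definition "s t = x (Suc t) - x t"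
definition "y t = g (x (Suc t)) - g (x t)"
definition "gap t = f (x t) - f xopt"

text \<open>
  With \<open>P\<close>-weighted vectors \<open>g' = P\<^sup>-\<^sup>1\<^sup>/\<^sup>2 g\<close>, \<open>s' = P\<^sup>1\<^sup>/\<^sup>2 s\<close> and \<open>y' = P\<^sup>-\<^sup>1\<^sup>/\<^sup>2 y\<close> this is the squared
  cosine of the angle between \<open>g'\<close> and \<open>s'\<close>, divided by the curvature \<open>(s' \<bullet> y') / (s' \<bullet> s')\<close>. The
  norm of \<open>s'\<close> cancels.
\<close>

definition curvature_ratio :: "real^'n^'n \<Rightarrow> nat \<Rightarrow> real" where
  "curvature_ratio P t = (g (x t) \<bullet> s t)\<^sup>2 / ((g (x t) \<bullet> (matrix_inv P *v g (x t))) * (s t \<bullet> y t))"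

lemma iteration:
  shows gradient_nonzero: "g (x t) \<noteq> 0"
    and step_pos: "\<eta> t > 0"
    and x_Suc: "x (Suc t) = x t + \<eta> t *\<^sub>R bfgs_direction (B t) (g (x t))"
    and B_Suc: "B (Suc t) = bfgs_update (B t) (s t) (y t)"
    and B_0: "symmetric_pos_def (B 0)"
  using iterates unfolding bfgs_sequence_def s_def y_def by blast+

lemma gap_iterate_pos: "gap t > 0"
  unfolding gap_def by (intro gap_pos gradient_nonzero)

lemma s_eq: "s t = \<eta> t *\<^sub>R bfgs_direction (B t) (g (x t))"
  by (simp add: s_def x_Suc)

lemma
  assumes "symmetric_pos_def (B t)"
  shows B_times_s: "B t *v s t = (- \<eta> t) *\<^sub>R g (x t)"
    and s_nonzero: "s t \<noteq> 0"
    and descent: "g (x t) \<bullet> s t < 0"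
    and sy_pos: "s t \<bullet> y t > 0"
proof -
  note \<eta> = step_pos[of t] and g = gradient_nonzero[of t]
  have s: "s t = (- \<eta> t) *\<^sub>R (matrix_inv (B t) *v g (x t))" by (simp add: s_eq bfgs_direction_def)
  show "B t *v s t = (- \<eta> t) *\<^sub>R g (x t)"
    by (simp only: s matrix_vector_mult_scaleR symmetric_pos_def_inverse(4)[OF assms])
  have "g (x t) \<bullet> (matrix_inv (B t) *v g (x t)) > 0"
    using symmetric_pos_def_inverse(5)[OF assms g] .
  then show "g (x t) \<bullet> s t < 0" using \<eta> by (simp add: s)
  then show s0: "s t \<noteq> 0" by auto
  have "y t \<bullet> s t \<ge> \<mu> * (norm (s t))\<^sup>2"
    using gradient_strongly_monotone by (simp add: y_def s_def)
  moreover have "\<mu> * (norm (s t))\<^sup>2 > 0" using s0 \<mu>_pos by simp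
  ultimately show "s t \<bullet> y t > 0" by (simp add: inner_commute)
qed

lemma B_pos_def: "symmetric_pos_def (B t)"
proof (induction t)
  case 0
  show ?case by (rule B_0)
next
  case (Suc t)
  show ?case
    unfolding B_Suc
    by (rule bfgs_update_pos_def_and_det(1)[OF Suc s_nonzero[OF Suc] sy_pos[OF Suc]])
qed

lemma weighted_gradient_pos:
  assumes "symmetric_pos_def P"
  shows "g (x t) \<bullet> (matrix_inv P *v g (x t)) > 0"
  by (rule symmetric_pos_def_inverse(5)[OF assms gradient_nonzero])

lemma curvature_ratio_pos: "symmetric_pos_def P \<Longrightarrow> curvature_ratio P t > 0"
  using weighted_gradient_pos[of P t] descent[OF B_pos_def, of t] sy_pos[OF B_pos_def, of t]
  by (simp add: curvature_ratio_def)

lemma armijo_decrease: "f (x (Suc t)) \<le> f (x t) + \<alpha> * (g (x t) \<bullet> s t)"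
  and wolfe_curvature: "(1 - \<beta>) * - (g (x t) \<bullet> s t) \<le> s t \<bullet> y t"
proof -
  define p where "p = bfgs_direction (B t) (g (x t))"
  note \<eta> = step_pos[of t]
  have xs: "x (Suc t) = x t + \<eta> t *\<^sub>R p" unfolding p_def by (rule x_Suc)
  have sp: "s t = \<eta> t *\<^sub>R p" by (simp add: s_eq p_def)
  show "f (x (Suc t)) \<le> f (x t) + \<alpha> * (g (x t) \<bullet> s t)"
    using line_search[of t] by (simp add: armijo_wolfe_def xs sp flip: p_def)
  have "\<beta> * (g (x t) \<bullet> p) \<le> g (x (Suc t)) \<bullet> p"
    using line_search[of t] by (simp add: armijo_wolfe_def xs flip: p_def)
  then have "\<eta> t * (\<beta> * (g (x t) \<bullet> p)) \<le> \<eta> t * (g (x (Suc t)) \<bullet> p)"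
    using \<eta> by (intro mult_left_mono) auto
  then show "(1 - \<beta>) * - (g (x t) \<bullet> s t) \<le> s t \<bullet> y t"
    by (simp add: sp y_def inner_diff_left inner_diff_right inner_commute[of p] algebra_simps)
qed

lemma gap_antimono: "gap (Suc t) \<le> gap t"
  using armijo_decrease[of t] mult_pos_neg[OF \<alpha>_pos descent[OF B_pos_def, of t]]
  by (simp add: gap_def)

lemma gap_le_initial: "gap t \<le> gap 0"
  by (induction t) (use gap_antimono order_trans in blast)+

text \<open>
  The Armijo condition gains \<open>\<alpha> a\<close> with \<open>a = - (g \<bullet> s)\<close>, and the Wolfe condition allows one factor
  of \<open>a = a\<^sup>2 / a\<close> to be traded for \<open>s \<bullet> y\<close>, which is the denominator of the curvature ratio.
\<close>

lemma gap_decrease: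
  assumes P: "symmetric_pos_def P"
  shows "\<alpha> * (1 - \<beta>) * curvature_ratio P t * (g (x t) \<bullet> (matrix_inv P *v g (x t))) \<le> gap t - gap (Suc t)"
proof -
  define a where "a = - (g (x t) \<bullet> s t)"
  have a: "a > 0" using descent[OF B_pos_def, of t] by (simp add: a_def)
  have sy: "s t \<bullet> y t > 0" by (rule sy_pos[OF B_pos_def])
  have "curvature_ratio P t * (g (x t) \<bullet> (matrix_inv P *v g (x t))) = a * a / (s t \<bullet> y t)"
    using weighted_gradient_pos[OF P, of t] by (simp add: curvature_ratio_def a_def power2_eq_square)
  then have "\<alpha> * (1 - \<beta>) * curvature_ratio P t * (g (x t) \<bullet> (matrix_inv P *v g (x t)))
      = \<alpha> * (a * ((1 - \<beta>) * a / (s t \<bullet> y t)))"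
    by (simp add: mult.assoc)
  also have "\<dots> \<le> \<alpha> * (a * 1)"
  proof (intro mult_left_mono)
    have "(1 - \<beta>) * a \<le> s t \<bullet> y t" unfolding a_def by (rule wolfe_curvature)
    then show "(1 - \<beta>) * a / (s t \<bullet> y t) \<le> 1" using sy by (simp add: pos_divide_le_eq)
  qed (use a \<alpha>_pos in auto)
  also have "\<dots> \<le> gap t - gap (Suc t)"
    using armijo_decrease[of t] by (simp add: gap_def a_def)
  finally show ?thesis .
qed

text \<open>
  The quasi-Newton equation \<open>B s = - \<eta> g\<close> identifies the quality term of the divergence estimate
  with the curvature ratio; the step size cancels.
\<close>

lemma logdet_divergence_step:
  assumes P: "symmetric_pos_def P" and K: "y t \<bullet> (matrix_inv P *v y t) \<le> K * (s t \<bullet> y t)"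
  shows "logdet_divergence (B (Suc t)) P \<le> logdet_divergence (B t) P + (K - 1) + ln (curvature_ratio P t)"
proof -
  note \<eta> = step_pos[of t]
  have sy: "s t \<bullet> y t > 0" by (rule sy_pos[OF B_pos_def])
  define b where "b = B t *v s t"
  have b: "b = (- \<eta> t) *\<^sub>R g (x t)" unfolding b_def by (rule B_times_s[OF B_pos_def])
  have "(s t \<bullet> b)\<^sup>2 / ((b \<bullet> (matrix_inv P *v b)) * (s t \<bullet> y t)) = curvature_ratio P t"
  proof -
    have "s t \<bullet> b = - \<eta> t * (g (x t) \<bullet> s t)" by (simp add: b inner_commute)
    moreover have "b \<bullet> (matrix_inv P *v b) = (\<eta> t)\<^sup>2 * (g (x t) \<bullet> (matrix_inv P *v g (x t)))"
      unfolding b by (simp only: matrix_vector_mult_scaleR) (simp add: power2_eq_square)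
    ultimately show ?thesis using \<eta> by (simp add: curvature_ratio_def power_mult_distrib)
  qed
  moreover have "y t \<bullet> (matrix_inv P *v y t) / (s t \<bullet> y t) \<le> K"
    using K sy by (simp add: field_simps)
  ultimately show ?thesis
    using logdet_divergence_bfgs_update[OF B_pos_def P s_nonzero[OF B_pos_def] sy, of t]
    unfolding B_Suc b_def by simp
qed

text \<open>
  The divergence can never become negative, so its telescoping sum limits how often the curvature
  ratio can be small.
\<close>

lemma sum_ln_curvature_ratio:
  assumes P: "symmetric_pos_def P"
    and K: "\<And>i. y i \<bullet> (matrix_inv P *v y i) \<le> K i * (s i \<bullet> y i)"
  shows "(\<Sum>i<t. ln (curvature_ratio P i)) \<ge> - logdet_divergence (B 0) P - (\<Sum>i<t. K i - 1)"
proof -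
  have "logdet_divergence (B t) P \<le>
      logdet_divergence (B 0) P + (\<Sum>i<t. K i - 1) + (\<Sum>i<t. ln (curvature_ratio P i))"
  proof (induction t)
    case (Suc t)
    then show ?case using logdet_divergence_step[OF P K[of t]] by simp
  qed simp
  with logdet_divergence_nonneg[OF B_pos_def[of t] P] show ?thesis by simp
qed

lemma rate_constant:
  assumes "k \<ge> 1"
  shows "0 < 2 * \<alpha> * (1 - \<beta>) / (3 * k)" and "2 * \<alpha> * (1 - \<beta>) / (3 * k) < 1"
proof -
  have "2 * \<alpha> * (1 - \<beta>) < 1 * 1"
    using \<alpha>_pos \<alpha>_less \<beta>_pos \<beta>_less by (intro mult_strict_mono) auto
  then show "2 * \<alpha> * (1 - \<beta>) / (3 * k) < 1" using assms by (simp add: pos_divide_less_eq)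
  show "0 < 2 * \<alpha> * (1 - \<beta>) / (3 * k)" using assms \<alpha>_pos \<beta>_less by simp
qed

text \<open>
  The relative decrease in step \<open>i\<close> is at least \<open>2 \<alpha> (1 - \<beta>) w / K'\<close> for the curvature ratio \<open>w\<close>.
  The factor \<open>k\<close> is the part of \<open>K'\<close> that is accepted as a loss in the rate; the rest,
  \<open>b = w k / K'\<close>, is at least \<open>1 / 3\<close> on average as soon as the accumulated logarithmic losses are
  at most one per step, which is the budget hypothesis.
\<close>

lemma weighted_linear_rate:
  fixes K K' :: "nat \<Rightarrow> real"
  assumes P: "symmetric_pos_def P" and k: "k \<ge> 1"
    and K: "\<And>i. K i > 0" and K': "\<And>i. K' i > 0"
    and upper: "\<And>i r v. 0 < r \<Longrightarrow> r < 1 \<Longrightarrow>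
      v \<bullet> (H (x i + r *\<^sub>R s i) *v v) \<le> K i * (v \<bullet> (P *v v))"
    and lower: "\<And>i r v. 0 < r \<Longrightarrow> r < 1 \<Longrightarrow>
      v \<bullet> (P *v v) \<le> K' i * (v \<bullet> (H (x i + r *\<^sub>R (xopt - x i)) *v v))"
    and budget: "logdet_divergence (B 0) P + (\<Sum>i<t. K i - 1 + ln (K' i / k)) \<le> real t"
  shows "gap t \<le> (1 - 2 * \<alpha> * (1 - \<beta>) / (3 * k)) ^ t * gap 0"
proof -
  define G where "G i = g (x i) \<bullet> (matrix_inv P *v g (x i))" for i
  define w where "w i = curvature_ratio P i" for i
  define b where "b i = w i / (K' i / k)" for i
  have w: "w i > 0" for i unfolding w_def by (rule curvature_ratio_pos[OF P])
  have b: "b i > 0" for i using w K' k by (simp add: b_def)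
  have coc: "y i \<bullet> (matrix_inv P *v y i) \<le> K i * (s i \<bullet> y i)" for i
    using weighted_cocoercivity[OF P K, of "x i" "s i" i] upper by (simp add: y_def s_def)
  have lnb: "ln (b i) = ln (w i) - ln (K' i / k)" for i
    using w[of i] K'[of i] k by (subst b_def, subst ln_div) auto
  have "(\<Sum>i<t. ln (b i)) \<ge> - real t"
    using sum_ln_curvature_ratio[OF P coc, of t] budget
    by (simp add: lnb sum_subtractf sum.distrib w_def)
  then have sumb: "(\<Sum>i<t. b i) \<ge> real t / 3"
    by (intro sum_ge_third_of_sum_ln_ge b)
  define c where "c = 2 * \<alpha> * (1 - \<beta>) / k"
  have c: "c \<ge> 0" using \<alpha>_pos \<beta>_less k by (simp add: c_def)
  have step: "gap (Suc i) \<le> (1 - c * b i) * gap i" for i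
  proof -
    have "gap i \<le> K' i / 2 * G i"
      unfolding gap_def G_def by (rule weighted_gap_bound[OF P K' lower])
    then have "c * b i * gap i \<le> c * b i * (K' i / 2 * G i)"
      using c b[of i] by (intro mult_left_mono) auto
    also have "\<dots> = \<alpha> * (1 - \<beta>) * w i * G i"
      using K'[of i] k by (simp add: c_def b_def)
    also have "\<dots> \<le> gap i - gap (Suc i)"
      unfolding w_def G_def by (rule gap_decrease[OF P])
    finally show ?thesis by (simp add: algebra_simps)
  qed
  have "(\<Sum>i<t. c * b i) \<ge> real t * (2 * \<alpha> * (1 - \<beta>) / (3 * k))"
  proof -
    have "real t * (2 * \<alpha> * (1 - \<beta>) / (3 * k)) = c * (real t / 3)"
      by (simp add: c_def mult.commute)
    also have "\<dots> \<le> c * (\<Sum>i<t. b i)" using c sumb by (rule mult_left_mono[rotated])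
    finally show ?thesis by (simp add: sum_distrib_left)
  qed
  then show ?thesis
    using step gap_iterate_pos rate_constant(2)[OF k]
    by (intro contraction_product_le_power[where a="\<lambda>i. c * b i"]) (auto intro: less_imp_le)
qed

abbreviation "\<kappa> \<equiv> L / \<mu>"
abbreviation "C t \<equiv> C_const M \<mu> f xopt (x t)"

lemma kappa_ge_1: "\<kappa> \<ge> 1"
proof -
  fix k :: 'n
  define e :: "real^'n" where "e = axis k 1"
  have "\<mu> * (e \<bullet> e) \<le> L * (e \<bullet> e)"
    using hessian_bounds[of e 0] by linarith
  then show ?thesis using \<mu>_pos by (simp add: e_def inner_axis_axis)
qed

text \<open>
  The weight \<open>L I\<close> dominates every Hessian, and is dominated by \<open>\<kappa>\<close> times any of them; the rate pays
  for the condition number.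
\<close>

lemma global_linear_rate:
  assumes "logdet_divergence (B 0) (L *\<^sub>R mat 1) \<le> real t"
  shows "gap t \<le> (1 - 2 * \<alpha> * (1 - \<beta>) / (3 * \<kappa>)) ^ t * gap 0"
proof (rule weighted_linear_rate[where K="\<lambda>_. 1" and K'="\<lambda>_. \<kappa>"])
  show "symmetric_pos_def (L *\<^sub>R (mat 1 :: real^'n^'n))" by (rule scaled_identity_pos_def[OF L_pos])
  show "1 \<le> \<kappa>" by (rule kappa_ge_1)
  show "v \<bullet> (H z *v v) \<le> 1 * (v \<bullet> (L *\<^sub>R mat 1 *v v))" for v z
    using hessian_bounds(2) by (simp flip: scaleR_matrix_vector_assoc)
  show "v \<bullet> (L *\<^sub>R mat 1 *v v) \<le> \<kappa> * (v \<bullet> (H z *v v))" for v z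
    using mult_left_mono[OF hessian_bounds(1)[of v z], of \<kappa>] L_pos \<mu>_pos
    by (simp flip: scaleR_matrix_vector_assoc)
  show "logdet_divergence (B 0) (L *\<^sub>R mat 1) + (\<Sum>i<t. 1 - 1 + ln (\<kappa> / \<kappa>)) \<le> real t"
    using assms L_pos \<mu>_pos by simp
qed (use L_pos \<mu>_pos in auto)

lemma C_nonneg: "C t \<ge> 0"
  using M_pos minimum by (simp add: C_const_def)

text \<open>
  Weighted by the Hessian at the minimiser, the function has condition number close to one near that
  point. The deviation costs \<open>C\<close> once through co-coercivity and at most \<open>C\<close> once more through the gap bound.
\<close>

lemma local_linear_rate:
  assumes "logdet_divergence (B 0) (H xopt) + 2 * (\<Sum>i<t. C i) \<le> real t"
  shows "gap t \<le> (1 - 2 * \<alpha> * (1 - \<beta>) / 3) ^ t * gap 0"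
proof -
  have "gap t \<le> (1 - 2 * \<alpha> * (1 - \<beta>) / (3 * 1)) ^ t * gap 0"
  proof (rule weighted_linear_rate[where K="\<lambda>i. 1 + C i" and K'="\<lambda>i. 1 + C i"])
    show "symmetric_pos_def (H xopt)" by (rule hessian_pos_def)
    fix i r v assume r: "0 < r" "(r :: real) < 1"
    have "f (x i + r *\<^sub>R s i) \<le> f (x i)"
      unfolding s_def using gap_antimono[of i] r by (intro segment_le) (simp_all add: gap_def)
    then show "v \<bullet> (H (x i + r *\<^sub>R s i) *v v) \<le> (1 + C i) * (v \<bullet> (H xopt *v v))"
      by (rule hessian_near_optimum)
    have "f (x i + r *\<^sub>R (xopt - x i)) \<le> f (x i)"
      using r minimum by (intro segment_le)
    then show "v \<bullet> (H xopt *v v) \<le> (1 + C i) * (v \<bullet> (H (x i + r *\<^sub>R (xopt - x i)) *v v))"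
      by (rule hessian_near_optimum)
  next
    have "1 + C i - 1 + ln ((1 + C i) / 1) \<le> 2 * C i" for i
      using ln_add_one_self_le_self[OF C_nonneg[of i]] by simp
    then have "(\<Sum>i<t. 1 + C i - 1 + ln ((1 + C i) / 1)) \<le> (\<Sum>i<t. 2 * C i)"
      by (rule sum_mono)
    then show "logdet_divergence (B 0) (H xopt) + (\<Sum>i<t. 1 + C i - 1 + ln ((1 + C i) / 1)) \<le> real t"
      using assms by (simp add: sum_distrib_left)
  qed (use C_nonneg in \<open>auto intro: add_pos_nonneg\<close>)
  then show ?thesis by simp
qed

text \<open>
  The errors \<open>C i\<close> are proportional to the square root of the gap. They do not exceed \<open>C 0\<close>, and
  after the first \<open>Kglob\<close> iterations they lie below a geometric sequence by the condition-number
  dependent rate.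
\<close>

lemma hessian_error_sum_le:
  assumes Kglob: "logdet_divergence (B 0) (L *\<^sub>R mat 1) \<le> Kglob" "Kglob \<ge> 0"
  shows "(\<Sum>i<t. C i) \<le> C 0 * (Kglob + 1) + 3 * C 0 * (\<kappa> / (\<alpha> * (1 - \<beta>)))"
proof -
  define c where "c = 2 * \<alpha> * (1 - \<beta>) / (3 * \<kappa>)"
  define \<rho> where "\<rho> = sqrt (1 - c)"
  have c: "0 < c" "c < 1"
    unfolding c_def by (rule rate_constant[OF kappa_ge_1])+
  have \<rho>: "0 \<le> \<rho>" "\<rho> < 1" using c by (simp_all add: \<rho>_def)
  have C_eq: "C i = C 0 * sqrt (gap i / gap 0)" for i
    using gap_iterate_pos[of 0]
    by (simp add: C_const_def real_sqrt_mult real_sqrt_divide flip: gap_def)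
  have bound: "sqrt (gap i / gap 0) \<le> (if real i < Kglob then 1 else 0) + \<rho> ^ i" for i
  proof (cases "real i < Kglob")
    case True
    have "gap i / gap 0 \<le> 1" using gap_le_initial[of i] gap_iterate_pos[of 0] by simp
    then have "sqrt (gap i / gap 0) \<le> 1" by simp
    with True \<rho> show ?thesis by (simp add: add_increasing2)
  next
    case False
    then have "gap i \<le> (1 - c) ^ i * gap 0"
      unfolding c_def using Kglob by (intro global_linear_rate) simp
    then have "gap i / gap 0 \<le> (1 - c) ^ i" using gap_iterate_pos[of 0] by (simp add: pos_divide_le_eq)
    then have "sqrt (gap i / gap 0) \<le> sqrt ((1 - c) ^ i)" by (rule real_sqrt_le_mono)
    with False show ?thesis by (simp add: \<rho>_def real_sqrt_power)
  qed
  have "(\<Sum>i<t. if real i < Kglob then 1 else 0 :: real) = real (card {i. i < t \<and> real i < Kglob})"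
    by (simp add: sum.If_cases Int_def)
  also have "card {i. i < t \<and> real i < Kglob} \<le> card {..<nat \<lceil>Kglob\<rceil>}"
    by (intro card_mono) (auto simp: less_ceiling_iff zless_nat_eq_int_zless)
  then have "real (card {i. i < t \<and> real i < Kglob}) \<le> Kglob + 1" using Kglob(2) by simp linarith
  finally have S1: "(\<Sum>i<t. if real i < Kglob then 1 else 0 :: real) \<le> Kglob + 1" .
  have "(\<Sum>i<t. \<rho> ^ i) \<le> 1 / (1 - \<rho>)"
    using \<rho> by (simp add: sum_gp_strict divide_right_mono)
  also have "\<dots> \<le> 2 / c"
  proof -
    have "\<rho> * \<rho> = 1 - c" using c by (simp add: \<rho>_def)
    then have "c = (1 + \<rho>) * (1 - \<rho>)" by (simp add: algebra_simps)
    also have "\<dots> \<le> 2 * (1 - \<rho>)" using \<rho> by (intro mult_right_mono) auto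
    finally show ?thesis using c \<rho> by (simp add: field_simps)
  qed
  also have "2 / c = 3 * (\<kappa> / (\<alpha> * (1 - \<beta>)))" using \<alpha>_pos \<beta>_less by (simp add: c_def)
  finally have S2: "(\<Sum>i<t. \<rho> ^ i) \<le> 3 * (\<kappa> / (\<alpha> * (1 - \<beta>)))" .
  have "(\<Sum>i<t. C i) \<le> (\<Sum>i<t. C 0 * ((if real i < Kglob then 1 else 0) + \<rho> ^ i))"
    using C_nonneg[of 0] bound by (subst C_eq) (intro sum_mono mult_left_mono, auto)
  also have "\<dots> = C 0 * ((\<Sum>i<t. if real i < Kglob then 1 else 0) + (\<Sum>i<t. \<rho> ^ i))"
    by (simp only: sum.distrib flip: sum_distrib_left)
  also have "\<dots> \<le> C 0 * ((Kglob + 1) + 3 * (\<kappa> / (\<alpha> * (1 - \<beta>))))"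
    using C_nonneg[of 0] S1 S2 by (intro mult_left_mono add_mono)
  finally show ?thesis by (simp add: algebra_simps)
qed

text \<open>
  After the stated number of iterations the budget of the local rate is met. The constant 9 is
  \<open>2 * 3\<close> from twice the geometric sum, plus a remainder that absorbs the one iteration lost in
  rounding \<open>Kglob\<close> up.
\<close>

lemma condition_number_free_rate:
  assumes Kglob: "logdet_divergence (B 0) (L *\<^sub>R mat 1) \<le> Kglob" "Kglob \<ge> 0"
    and Kloc: "logdet_divergence (B 0) (H xopt) \<le> Kloc"
    and t: "real t \<ge> Kloc + 2 * C 0 * Kglob + 9 / (\<alpha> * (1 - \<beta>)) * C 0 * \<kappa>"
  shows "(f (x t) - f xopt) / (f (x 0) - f xopt) \<le> (1 - 2 * \<alpha> * (1 - \<beta>) / 3) ^ t"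
proof -
  define D where "D = \<kappa> / (\<alpha> * (1 - \<beta>))"
  have "\<alpha> * (1 - \<beta>) \<le> 1 * 1"
    using \<alpha>_pos \<alpha>_less \<beta>_pos \<beta>_less by (intro mult_mono) auto
  then have "1 \<le> D"
    unfolding D_def using kappa_ge_1 \<alpha>_pos \<beta>_less by (subst pos_le_divide_eq) auto
  then have "C 0 * 1 \<le> C 0 * D" using C_nonneg[of 0] by (intro mult_left_mono)
  moreover have "9 / (\<alpha> * (1 - \<beta>)) * C 0 * \<kappa> = 9 * (C 0 * D)" by (simp add: D_def mult_ac)
  moreover have "(\<Sum>i<t. C i) \<le> C 0 * Kglob + C 0 + 3 * (C 0 * D)"
    using hessian_error_sum_le[OF Kglob, of t] by (simp add: D_def algebra_simps)
  ultimately have "logdet_divergence (B 0) (H xopt) + 2 * (\<Sum>i<t. C i) \<le> real t"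
    using Kloc t C_nonneg[of 0] by linarith
  from local_linear_rate[OF this] show ?thesis
    using gap_iterate_pos[of 0] by (simp add: pos_divide_le_eq flip: gap_def)
qed

text \<open>
  In both comparisons the generalised eigenvalues are at least \<open>c / L\<close>, since \<open>L I\<close> dominates the
  Hessian.
\<close>

lemma scaled_identity_divergence_le:
  assumes c: "c > 0" and B0: "B 0 = c *\<^sub>R mat 1"
  shows "logdet_divergence (B 0) (L *\<^sub>R mat 1) \<le> real CARD('n) * (c / L - 1 - ln (c / L))"
    and "logdet_divergence (B 0) (H xopt) \<le> real CARD('n) * (c / \<mu> - 1 - ln (c / L))"
proof -
  have q: "w \<bullet> (B 0 *v w) = c * (w \<bullet> w)" for w
    by (simp add: B0 flip: scaleR_matrix_vector_assoc)
  have pos: "symmetric_pos_def (L *\<^sub>R (mat 1 :: real^'n^'n))" by (rule scaled_identity_pos_def[OF L_pos])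
  show "logdet_divergence (B 0) (L *\<^sub>R mat 1) \<le> real CARD('n) * (c / L - 1 - ln (c / L))"
    using L_pos c by (intro logdet_divergence_le B_pos_def pos)
      (simp_all add: q flip: scaleR_matrix_vector_assoc)
  show "logdet_divergence (B 0) (H xopt) \<le> real CARD('n) * (c / \<mu> - 1 - ln (c / L))"
  proof (intro logdet_divergence_le B_pos_def hessian_pos_def)
    show "c / L > 0" using c L_pos by simp
    show "c / L * (w \<bullet> (H xopt *v w)) \<le> w \<bullet> (B 0 *v w)" for w
      using mult_left_mono[OF hessian_bounds(2)[of w xopt], of "c / L"] c L_pos by (simp add: q)
    show "w \<bullet> (B 0 *v w) \<le> c / \<mu> * (w \<bullet> (H xopt *v w))" for w
      using mult_left_mono[OF hessian_bounds(1)[of w xopt], of "c / \<mu>"] c \<mu>_pos by (simp add: q)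
  qed
qed

end

theorem corollary5p3:
  fixes f :: "real^'n \<Rightarrow> real" and g :: "real^'n \<Rightarrow> real^'n" and H :: "real^'n \<Rightarrow> real^'n^'n"
    and \<mu> L M \<kappa> \<alpha> \<beta> C0 :: real and xopt :: "real^'n"
    and \<eta> :: "nat \<Rightarrow> real" and x :: "nat \<Rightarrow> real^'n" and B :: "nat \<Rightarrow> real^'n^'n"
  assumes "has_gradient_hessian f g H"
    and "\<mu> > 0" and "strongly_convex \<mu> f"
    and "L > 0" and "L-lipschitz_on UNIV g"
    and "M > 0" and "\<forall>u v. spectral_norm (H u - H v) \<le> M * norm (u - v)"
    and "\<kappa> = L / \<mu>"
    and "\<forall>u. f xopt \<le> f u"
    and "0 < \<alpha>" and "\<alpha> < \<beta>" and "\<beta> < 1" and "\<alpha> < 1/2"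
    and "bfgs_sequence g \<eta> x B"
    and "\<forall>t. armijo_wolfe \<alpha> \<beta> f g (x t) (bfgs_direction (B t) (g (x t))) (\<eta> t)"
    and "C0 = C_const M \<mu> f xopt (x 0)"
  shows "(B 0 = L *\<^sub>R mat 1 \<longrightarrow>
           (\<forall>t::nat. real t \<ge> real CARD('n) * \<kappa> + 9 / (\<alpha> * (1 - \<beta>)) * C0 * \<kappa> \<longrightarrow>
              (f (x t) - f xopt) / (f (x 0) - f xopt) \<le> (1 - 2 * \<alpha> * (1 - \<beta>) / 3) ^ t))
       \<and> (B 0 = \<mu> *\<^sub>R mat 1 \<longrightarrow>
           (\<forall>t::nat. real t \<ge> (1 + 3 * C0) * real CARD('n) * ln \<kappa> + 9 / (\<alpha> * (1 - \<beta>)) * C0 * \<kappa> \<longrightarrow>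
              (f (x t) - f xopt) / (f (x 0) - f xopt) \<le> (1 - 2 * \<alpha> * (1 - \<beta>) / 3) ^ t))"
proof -
  interpret bfgs_run f g H \<mu> L M xopt \<alpha> \<beta> \<eta> x B
    using assms by unfold_locales auto
  note \<kappa> = \<open>\<kappa> = L / \<mu>\<close> and C0 = \<open>C0 = C_const M \<mu> f xopt (x 0)\<close>
  have C0_nonneg: "C0 \<ge> 0" using C_nonneg[of 0] by (simp add: C0)
  show ?thesis
  proof (intro conjI impI allI)
    fix t :: nat
    assume B0: "B 0 = L *\<^sub>R mat 1"
      and t: "real t \<ge> real CARD('n) * \<kappa> + 9 / (\<alpha> * (1 - \<beta>)) * C0 * \<kappa>"
    have "logdet_divergence (B 0) (L *\<^sub>R mat 1) \<le> 0"
      "logdet_divergence (B 0) (H xopt) \<le> real CARD('n) * (L / \<mu> - 1)"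
      using scaled_identity_divergence_le[OF L_pos B0] L_pos by simp_all
    moreover have "real CARD('n) * (L / \<mu> - 1) \<le> real CARD('n) * \<kappa>"
      unfolding \<kappa> by (intro mult_left_mono) auto
    ultimately show "(f (x t) - f xopt) / (f (x 0) - f xopt) \<le> (1 - 2 * \<alpha> * (1 - \<beta>) / 3) ^ t"
      using t by (intro condition_number_free_rate[where Kglob=0 and Kloc="real CARD('n) * \<kappa>"])
        (simp_all add: \<kappa> C0)
  next
    fix t :: nat
    define K where "K = real CARD('n) * ln \<kappa>"
    assume B0: "B 0 = \<mu> *\<^sub>R mat 1"
      and t: "real t \<ge> (1 + 3 * C0) * real CARD('n) * ln \<kappa> + 9 / (\<alpha> * (1 - \<beta>)) * C0 * \<kappa>"
    have "1 \<le> \<kappa>" using kappa_ge_1 by (simp add: \<kappa>)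
    then have K: "K \<ge> 0" by (simp add: K_def)
    have ln: "- ln (\<mu> / L) = ln \<kappa>" using \<mu>_pos L_pos by (simp add: \<kappa> ln_div)
    have "real CARD('n) * (\<mu> / L - 1 - ln (\<mu> / L)) \<le> K"
      unfolding K_def ln[symmetric] using \<open>1 \<le> \<kappa>\<close> \<mu>_pos L_pos
      by (intro mult_left_mono) (simp_all add: \<kappa>)
    then have 1: "logdet_divergence (B 0) (L *\<^sub>R mat 1) \<le> K"
      using scaled_identity_divergence_le(1)[OF \<mu>_pos B0] by simp
    have 2: "logdet_divergence (B 0) (H xopt) \<le> K"
      using scaled_identity_divergence_le(2)[OF \<mu>_pos B0] \<mu>_pos
      by (simp add: K_def ln[symmetric])
    have "0 \<le> C0 * K" using C0_nonneg K by simp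
    moreover have "(1 + 3 * C0) * real CARD('n) * ln \<kappa> = K + 3 * (C0 * K)"
      by (simp add: K_def algebra_simps)
    ultimately have "real t \<ge> K + 2 * C0 * K + 9 / (\<alpha> * (1 - \<beta>)) * C0 * \<kappa>" using t by simp
    then show "(f (x t) - f xopt) / (f (x 0) - f xopt) \<le> (1 - 2 * \<alpha> * (1 - \<beta>) / 3) ^ t"
      using 1 2 K by (intro condition_number_free_rate[where Kglob=K and Kloc=K]) (simp_all add: \<kappa> C0)
  qed
qed

end
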